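(* Let $n\ge1$ and let $\alpha,\beta\in\mathbb C^n$ satisfy $\Re\alpha_j+\Re\beta_j>-1$ and $\alpha_j,\beta_j\notin\{-1,-2,\ldots\}$ for all $1\le j\le n$. Assume that $u\in sh_{\alpha,\beta}(\mathbb D^n)$ is $m$-homogeneous for some $m\in\mathbb Z^n$. Then, for some constant $c\in\mathbb C$, $$u(z)=c\prod_{j=1}^n F(m_j^+-\beta_j,\,m_j^--\alpha_j;\,m_j^++m_j^-+1;\,|z_j|^2)\,z_j^{m_j^+}\,\overline{z_j}^{\,m_j^-},\qquad z\in\mathbb D^n.$$ Conversely, every function $u$ of this form is $m$-homogeneous and separately $(\alpha,\beta)$-harmonic in $\mathbb D^n$.
   Context: $\mathbb D$ is the open unit disc, $\mathbb T$ the unit circle. For $1\le j\le n$, $$L_{\alpha_j,\beta_j}=(1-|z_j|^2)\frac{\partial^2}{\partial z_j\partial\overline{z_j}}+\alpha_jz_j\frac{\partial}{\partial z_j}+\beta_j\overline{z_j}\frac{\partial}{\partial\overline{z_j}}-\alpha_j\beta_j .$$ A function $u\in C^2(\mathbb D^n)$ (complex valued) is separately $(\alpha,\beta)$-harmonic if $L_{\alpha_j,\beta_j}u=0$ on $\mathbb D^n$ for all $1\le j\le n$; the space of these functions is $sh_{\alpha,\beta}(\mathbb D^n)$. For $m\in\mathbb Z^n$, a continuous function $u$ on $\mathbb D^n_0=\{z\in\mathbb D^n:\prod_jz_j\ne0\}$ is $m$-homogeneous if $u(\zeta_1z_1,\ldots,\zeta_nz_n)=\zeta_1^{m_1}\cdots\zeta_n^{m_n}u(z)$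 for all $z\in\mathbb D_0^n$, $\zeta\in\mathbb T^n$ (a function on $\mathbb D^n$ is called $m$-homogeneous if its restriction to $\mathbb D^n_0$ is). For a real $x$, $x^+=\max(x,0)$, $x^-=\max(-x,0)$. $F(a,b;c;x)=\sum_{k\ge0}\frac{(a)_k(b)_k}{(c)_k}\frac{x^k}{k!}$, $|x|<1$, is the Gauss hypergeometric function, where $(a)_0=1$, $(a)_k=a(a+1)\cdots(a+k-1)$. *)

theory Defs
  imports "HOL-Analysis.Analysis"
begin

definition polydisc :: "(complex ^ 'n) set" where
  "polydisc = {z. \<forall>j. cmod (z $ j) < 1}"

definition polydisc0 :: "(complex ^ 'n) set" where
  "polydisc0 = {z \<in> polydisc. (\<Prod>j\<in>UNIV. z $ j) \<noteq> 0}"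

definition torus :: "(complex ^ 'n) set" where
  "torus = {\<zeta>. \<forall>j. cmod (\<zeta> $ j) = 1}"

(* Differentiability is over the reals throughout.  A function on an open set S is represented
   by a total function whose values outside S are irrelevant. *)
definition C2_on :: "'a::real_normed_vector set \<Rightarrow> ('a \<Rightarrow> 'b::real_normed_vector) \<Rightarrow> bool" where
  "C2_on S u \<longleftrightarrow>
     (\<exists>(u' :: 'a \<Rightarrow> 'a \<Rightarrow>\<^sub>L 'b) (u'' :: 'a \<Rightarrow> 'a \<Rightarrow>\<^sub>L ('a \<Rightarrow>\<^sub>L 'b)).
        (\<forall>z\<in>S. (u has_derivative blinfun_apply (u' z)) (at z)) \<and>
        (\<forall>z\<in>S. (u' has_derivative blinfun_apply (u'' z)) (at z)) \<and>
        continuous_on S u'')"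

(* Partial derivatives in the real coordinates x_j, y_j of z_j = x_j + i y_j. *)
definition partial_x :: "'n \<Rightarrow> (complex ^ 'n \<Rightarrow> complex) \<Rightarrow> complex ^ 'n \<Rightarrow> complex" where
  "partial_x j u z = frechet_derivative u (at z) (axis j 1)"

definition partial_y :: "'n \<Rightarrow> (complex ^ 'n \<Rightarrow> complex) \<Rightarrow> complex ^ 'n \<Rightarrow> complex" where
  "partial_y j u z = frechet_derivative u (at z) (axis j \<i>)"

definition partial_z :: "'n \<Rightarrow> (complex ^ 'n \<Rightarrow> complex) \<Rightarrow> complex ^ 'n \<Rightarrow> complex" where
  "partial_z j u z = (partial_x j u z - \<i> * partial_y j u z) / 2"

definition partial_zbar :: "'n \<Rightarrow> (complex ^ 'n \<Rightarrow> complex) \<Rightarrow> complex ^ 'n \<Rightarrow> complex" where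
  "partial_zbar j u z = (partial_x j u z + \<i> * partial_y j u z) / 2"

definition L_op ::
    "complex \<Rightarrow> complex \<Rightarrow> 'n \<Rightarrow> (complex ^ 'n \<Rightarrow> complex) \<Rightarrow> complex ^ 'n \<Rightarrow> complex" where
  "L_op a b j u z =
     (1 - of_real ((cmod (z $ j))\<^sup>2)) * partial_z j (partial_zbar j u) z
     + a * (z $ j) * partial_z j u z
     + b * cnj (z $ j) * partial_zbar j u z
     - a * b * u z"

definition sep_harmonic ::
    "complex ^ 'n \<Rightarrow> complex ^ 'n \<Rightarrow> (complex ^ 'n \<Rightarrow> complex) set" where
  "sep_harmonic \<alpha> \<beta> =
     {u. C2_on polydisc u \<and> (\<forall>j. \<forall>z\<in>polydisc. L_op (\<alpha> $ j) (\<beta> $ j) j u z = 0)}"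

definition homogeneous :: "int ^ 'n \<Rightarrow> (complex ^ 'n \<Rightarrow> complex) \<Rightarrow> bool" where
  "homogeneous m u \<longleftrightarrow>
     continuous_on polydisc0 u \<and>
     (\<forall>z\<in>polydisc0. \<forall>\<zeta>\<in>torus.
        u (\<chi> j. \<zeta> $ j * z $ j) = (\<Prod>j\<in>UNIV. (\<zeta> $ j) powi (m $ j)) * u z)"

definition pos_part :: "int \<Rightarrow> int" where
  "pos_part x = max x 0"

definition neg_part :: "int \<Rightarrow> int" where
  "neg_part x = max (- x) 0"

definition hypergeo_F :: "complex \<Rightarrow> complex \<Rightarrow> complex \<Rightarrow> complex \<Rightarrow> complex" where
  "hypergeo_F a b c x =
     (\<Sum>k. pochhammer a k * pochhammer b k / pochhammer c k * (x ^ k / fact k))"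

end

theory Submission
  imports Defs
begin

text \<open>
  Fix all variables but one. A separately harmonic homogeneous function becomes a function \<open>v\<close>
  on the unit disc that satisfies \<open>v(\<zeta>w) = \<zeta>\<^sup>m v(w)\<close> for unimodular \<open>\<zeta>\<close> and is
  annihilated by the one-variable operator. Such a \<open>v\<close> is determined by its restriction to the
  radius \<open>(0,1)\<close>, where the angular derivative is known in terms of \<open>v\<close>. Hence \<open>v\<close> and
  its derivative \<open>d_zbar v\<close> with respect to \<open>cnj w\<close>, which is homogeneous of
  degree \<open>m + 1\<close>, satisfy a linear first-order system of two ordinary differential equations on the radius.

  The system is singular at the centre, and its solution space is two-dimensional. Smoothness of \<open>v\<close>
  at the centre cuts it down to one dimension: if \<open>W(r)\<close> is the Wronskian of two solutions that come
  from functions on the disc, then \<open>r W(r)\<close> satisfies a homogeneous linear equation that is regular at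
  \<open>0\<close>, and it vanishes at \<open>0\<close> because both solutions are bounded there. So it vanishes identically,
  and the two solutions are proportional (lemma \<open>disc_harmonic_homogeneous_proportional\<close>).
  On monomials times functions of \<open>\<bar>w\<bar>\<^sup>2\<close>, the operator turns into the hypergeometric operator, so
  one solution is the factor \<open>F(\<dots>; \<bar>w\<bar>\<^sup>2) w^(m\<^sup>+) (cnj w)^(m\<^sup>-)\<close>, called
  \<open>hypergeo_mode\<close> below (lemma \<open>disc_harmonic_hypergeo_mode\<close>).

  In several variables, pick in each coordinate a radius at which the mode does not vanish, and use
  proportionality to move one coordinate after the other to that radius; every move splits off one
  factor of the product. This works off the coordinate hyperplanes and extends by continuity.
  Conversely, each slice of the product is a multiple of a mode, and the product is twice continuously
  differentiable because it is built from coordinates, products and power series.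
\<close>

section \<open>Linear differential inequalities\<close>

text \<open>Uniqueness in the manner of Gronwall: \<open>\<bar>y\<bar>\<^sup>2\<close> times \<open>exp (\<plusminus>2Kt)\<close> is monotone, so a zero
  spreads to both sides. The derivative is only required in the interior, so that the lemma also applies
  to an interval that ends at a singular point of the equation for \<open>y\<close>.\<close>
lemma linear_differential_inequality_zero:
  fixes y :: "real \<Rightarrow> 'a::real_inner"
  assumes cont: "continuous_on {a..b} y"
    and der: "\<And>t. t \<in> {a<..<b} \<Longrightarrow> (y has_vector_derivative y' t) (at t)"
    and bound: "\<And>t. t \<in> {a<..<b} \<Longrightarrow> norm (y' t) \<le> K * norm (y t)"
    and c: "c \<in> {a..b}" "y c = 0" and t: "t \<in> {a..b}"
  shows "y t = 0"
proof -
  define E where "E = (\<lambda>s. y s \<bullet> y s)"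
  have E_cont: "continuous_on {a..b} E"
    unfolding E_def by (intro continuous_intros cont)
  have E_der: "(E has_real_derivative 2 * (y s \<bullet> y' s)) (at s)" if "s \<in> {a<..<b}" for s
    unfolding E_def has_field_derivative_def
    by (rule has_derivative_eq_rhs[OF has_derivative_inner])
       (use der[OF that] in \<open>auto simp: has_vector_derivative_def fun_eq_iff inner_commute algebra_simps\<close>)
  \<comment> \<open>The bound on the derivative of \<open>E\<close> is two-sided: this gives uniqueness to the left of \<open>c\<close> as well.\<close>
  have E_bound: "\<bar>2 * (y s \<bullet> y' s)\<bar> \<le> 2 * K * E s" if "s \<in> {a<..<b}" for s
  proof -
    have "\<bar>y s \<bullet> y' s\<bar> \<le> norm (y s) * norm (y' s)"
      by (rule Cauchy_Schwarz_ineq2)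
    also have "\<dots> \<le> norm (y s) * (K * norm (y s))"
      by (intro mult_left_mono bound that) auto
    also have "\<dots> = K * E s"
      by (simp add: E_def dot_square_norm power2_eq_square)
    finally show ?thesis by simp
  qed
  have "E t \<le> 0"
  proof (cases t c rule: linorder_cases)
    case less
    have "E t * exp (2 * K * t) \<le> E c * exp (2 * K * c)"
    proof (rule DERIV_nonneg_imp_increasing_open[where f = "\<lambda>s. E s * exp (2 * K * s)"])
      show "t \<le> c" using less by simp
      show "continuous_on {t..c} (\<lambda>s. E s * exp (2 * K * s))"
        using c t by (intro continuous_intros continuous_on_subset[OF E_cont]) auto
      fix s assume "t < s" "s < c"
      then have s: "s \<in> {a<..<b}" using c t by auto
      have "((\<lambda>s. E s * exp (2 * K * s)) has_real_derivative
              (2 * (y s \<bullet> y' s) + 2 * K * E s) * exp (2 * K * s)) (at s)"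
        by (auto intro!: derivative_eq_intros E_der[OF s] simp: algebra_simps)
      moreover have "0 \<le> (2 * (y s \<bullet> y' s) + 2 * K * E s) * exp (2 * K * s)"
        using E_bound[OF s] by (intro mult_nonneg_nonneg) auto
      ultimately show "\<exists>d. ((\<lambda>s. E s * exp (2 * K * s)) has_real_derivative d) (at s) \<and> 0 \<le> d"
        by blast
    qed
    then show ?thesis using c by (simp add: E_def mult_le_0_iff)
  next
    case equal
    then show ?thesis using c by (simp add: E_def)
  next
    case greater
    have "E t * exp (- (2 * K * t)) \<le> E c * exp (- (2 * K * c))"
    proof (rule DERIV_nonpos_imp_decreasing_open[where f = "\<lambda>s. E s * exp (- (2 * K * s))"])
      show "c \<le> t" using greater by simp
      show "continuous_on {c..t} (\<lambda>s. E s * exp (- (2 * K * s)))"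
        using c t by (intro continuous_intros continuous_on_subset[OF E_cont]) auto
      fix s assume "c < s" "s < t"
      then have s: "s \<in> {a<..<b}" using c t by auto
      have "((\<lambda>s. E s * exp (- (2 * K * s))) has_real_derivative
              (2 * (y s \<bullet> y' s) - 2 * K * E s) * exp (- (2 * K * s))) (at s)"
        by (auto intro!: derivative_eq_intros E_der[OF s] simp: algebra_simps)
      moreover have "(2 * (y s \<bullet> y' s) - 2 * K * E s) * exp (- (2 * K * s)) \<le> 0"
        using E_bound[OF s] by (intro mult_nonpos_nonneg) auto
      ultimately show "\<exists>d. ((\<lambda>s. E s * exp (- (2 * K * s))) has_real_derivative d) (at s) \<and> d \<le> 0"
        by blast
    qed
    then show ?thesis using c by (simp add: E_def mult_le_0_iff)
  qed
  then show ?thesis by (metis E_def inner_ge_zero inner_eq_zero_iff order_antisym)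
qed

section \<open>Wirtinger derivatives on the disc\<close>

definition d_z :: "(complex \<Rightarrow> complex) \<Rightarrow> complex \<Rightarrow> complex" where
  "d_z v w = (frechet_derivative v (at w) 1 - \<i> * frechet_derivative v (at w) \<i>) / 2"

definition d_zbar :: "(complex \<Rightarrow> complex) \<Rightarrow> complex \<Rightarrow> complex" where
  "d_zbar v w = (frechet_derivative v (at w) 1 + \<i> * frechet_derivative v (at w) \<i>) / 2"

text \<open>Every real-linear map of the plane is a combination of the identity and conjugation. Therefore a
  real derivative is the same as the pair of its Wirtinger coefficients, which may be computed by
  writing down any derivative of this form.\<close>
lemma real_linear_complex_eq:
  fixes f :: "complex \<Rightarrow> complex"
  assumes "bounded_linear f"
  shows "f h = (f 1 - \<i> * f \<i>) / 2 * h + (f 1 + \<i> * f \<i>) / 2 * cnj h"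
proof -
  interpret bounded_linear f by fact
  have "f h = f (Re h *\<^sub>R 1 + Im h *\<^sub>R \<i>)"
    by (rule arg_cong[of _ _ f]) (simp add: complex_eq_iff)
  also have "\<dots> = of_real (Re h) * f 1 + of_real (Im h) * f \<i>"
    unfolding add scaleR unfolding scaleR_conv_of_real ..
  also have "\<dots> = (f 1 - \<i> * f \<i>) / 2 * h + (f 1 + \<i> * f \<i>) / 2 * cnj h"
    by (simp add: complex_eq_iff algebra_simps add_divide_distrib diff_divide_distrib)
  finally show ?thesis .
qed

lemma has_derivative_wirtinger:
  assumes "v differentiable (at w)"
  shows "(v has_derivative (\<lambda>h. d_z v w * h + d_zbar v w * cnj h)) (at w)"
proof -
  have D: "(v has_derivative frechet_derivative v (at w)) (at w)"
    using assms frechet_derivative_works by blast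
  show ?thesis
    unfolding d_z_def d_zbar_def
    by (rule has_derivative_eq_rhs[OF D], rule ext,
        rule real_linear_complex_eq[OF has_derivative_bounded_linear[OF D]])
qed

lemma wirtinger_unique:
  assumes "(v has_derivative (\<lambda>h. A * h + B * cnj h)) (at w)"
  shows "d_z v w = A" "d_zbar v w = B"
  unfolding d_z_def d_zbar_def frechet_derivative_at[OF assms, symmetric]
  by (simp_all add: algebra_simps)

lemma wirtinger_cong:
  assumes "open S" "w \<in> S" "\<And>x. x \<in> S \<Longrightarrow> f x = g x" "f differentiable (at w)"
  shows "g differentiable (at w)" "d_z g w = d_z f w" "d_zbar g w = d_zbar f w"
proof -
  have "(g has_derivative (\<lambda>h. d_z f w * h + d_zbar f w * cnj h)) (at w)"
    by (rule has_derivative_transform_within_open[OF has_derivative_wirtinger]) (use assms in auto)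
  then show "g differentiable (at w)" "d_z g w = d_z f w" "d_zbar g w = d_zbar f w"
    using wirtinger_unique by (auto simp: differentiable_def)
qed

text \<open>The operator in one coordinate. Its second-order term is read as \<open>d_z\<close> of \<open>d_zbar v\<close>, in this
  order; because \<open>d_zbar v\<close> is again homogeneous, the equation becomes a first-order system for the
  pair of \<open>v\<close> and \<open>d_zbar v\<close>.\<close>
definition L_disc :: "complex \<Rightarrow> complex \<Rightarrow> (complex \<Rightarrow> complex) \<Rightarrow> complex \<Rightarrow> complex" where
  "L_disc a b v w = (1 - of_real ((cmod w)\<^sup>2)) * d_z (d_zbar v) w
     + a * w * d_z v w + b * cnj w * d_zbar v w - a * b * v w"

definition disc_harmonic :: "complex \<Rightarrow> complex \<Rightarrow> (complex \<Rightarrow> complex) \<Rightarrow> bool" where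
  "disc_harmonic a b v \<longleftrightarrow>
     (\<forall>w\<in>ball 0 1. v differentiable (at w) \<and> d_zbar v differentiable (at w) \<and> L_disc a b v w = 0)"

definition disc_homogeneous :: "int \<Rightarrow> (complex \<Rightarrow> complex) \<Rightarrow> bool" where
  "disc_homogeneous m v \<longleftrightarrow>
     (\<forall>w\<in>ball 0 1 - {0}. \<forall>\<zeta>. cmod \<zeta> = 1 \<longrightarrow> v (\<zeta> * w) = \<zeta> powi m * v w)"

text \<open>A slice of a product of modes agrees with a multiple of one mode, but only on the disc; this lemma
  transfers harmonicity to it.\<close>
lemma disc_harmonic_cong_scale:
  assumes v: "disc_harmonic a b v" and eq: "\<And>w. w \<in> ball 0 1 \<Longrightarrow> v' w = k * v w"
  shows "disc_harmonic a b v'"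
proof -
  have D: "(v has_derivative (\<lambda>h. d_z v w * h + d_zbar v w * cnj h)) (at w)"
    "(d_zbar v has_derivative (\<lambda>h. d_z (d_zbar v) w * h + d_zbar (d_zbar v) w * cnj h)) (at w)"
    and L: "L_disc a b v w = 0" if "w \<in> ball 0 1" for w
    using v that by (auto simp: disc_harmonic_def intro!: has_derivative_wirtinger)
  have scale: "(f' has_derivative (\<lambda>h. (k * A) * h + (k * B) * cnj h)) (at w)"
    if "(f has_derivative (\<lambda>h. A * h + B * cnj h)) (at w)" "w \<in> ball 0 1" "\<And>w. w \<in> ball 0 1 \<Longrightarrow> f' w = k * f w"
    for f f' A B w
  proof -
    have "((\<lambda>w. k * f w) has_derivative (\<lambda>h. (k * A) * h + (k * B) * cnj h)) (at w)"
      by (rule has_derivative_eq_rhs[OF has_derivative_mult_right[OF that(1)]]) (simp add: fun_eq_iff algebra_simps)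
    then show ?thesis
      by (rule has_derivative_transform_within_open[OF _ open_ball that(2)]) (simp add: that(3))
  qed
  note D' = scale[OF D(1) _ eq]
  have d: "d_z v' w = k * d_z v w" "d_zbar v' w = k * d_zbar v w" if "w \<in> ball 0 1" for w
    using wirtinger_unique[OF D'[OF that that]] by auto
  note D'' = scale[where f' = "d_zbar v'", OF D(2) _ d(2)]
  have dd: "d_z (d_zbar v') w = k * d_z (d_zbar v) w" if "w \<in> ball 0 1" for w
    by (rule wirtinger_unique(1)[OF D''[OF that that]])
  have "L_disc a b v' w = k * L_disc a b v w" if "w \<in> ball 0 1" for w
    by (simp only: L_disc_def d[OF that] dd[OF that] eq[OF that]) (simp add: algebra_simps)
  then show ?thesis
    unfolding disc_harmonic_def
    by (intro ballI conjI differentiableI[OF D'] differentiableI[OF D'']) (simp_all add: L)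
qed

text \<open>Differentiating \<open>v(\<zeta>w) = \<zeta>\<^sup>m v(w)\<close> gives a factor \<open>cnj \<zeta>\<close> on the left, and
  \<open>1 / cnj \<zeta> = \<zeta>\<close> raises the degree by one.\<close>
lemma disc_homogeneous_d_zbar:
  assumes hom: "disc_homogeneous m v" and diff: "\<And>w. w \<in> ball 0 1 \<Longrightarrow> v differentiable (at w)"
  shows "disc_homogeneous (m + 1) (d_zbar v)"
  unfolding disc_homogeneous_def
proof (intro ballI allI impI)
  fix w \<zeta> :: complex assume w: "w \<in> ball 0 1 - {0}" and \<zeta>: "cmod \<zeta> = 1"
  have \<zeta>0: "\<zeta> \<noteq> 0" and \<zeta>c: "\<zeta> * cnj \<zeta> = 1"
    using \<zeta> by (auto simp: complex_norm_square[symmetric])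
  have \<zeta>w: "\<zeta> * w \<in> ball 0 1" using w \<zeta> by (simp add: norm_mult)
  have "(v has_derivative (\<lambda>h. d_z v (\<zeta> * w) * h + d_zbar v (\<zeta> * w) * cnj h)) (at (\<zeta> * w))"
    by (intro has_derivative_wirtinger diff \<zeta>w)
  from has_derivative_compose[where f = "\<lambda>w. \<zeta> * w" and f' = "\<lambda>h. \<zeta> * h", OF _ this, OF has_derivative_mult_right[OF has_derivative_ident]]
  have D1: "((\<lambda>w. v (\<zeta> * w)) has_derivative
      (\<lambda>h. d_z v (\<zeta> * w) * (\<zeta> * h) + d_zbar v (\<zeta> * w) * cnj (\<zeta> * h))) (at w)"
    .
  have D1': "((\<lambda>w. v (\<zeta> * w)) has_derivative
      (\<lambda>h. (d_z v (\<zeta> * w) * \<zeta>) * h + (d_zbar v (\<zeta> * w) * cnj \<zeta>) * cnj h)) (at w)"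
    by (rule has_derivative_eq_rhs[OF D1]) (auto simp: fun_eq_iff algebra_simps)
  have "((\<lambda>w. \<zeta> powi m * v w) has_derivative
      (\<lambda>h. \<zeta> powi m * (d_z v w * h + d_zbar v w * cnj h))) (at w)"
    using w by (intro derivative_intros has_derivative_wirtinger diff) auto
  then have "((\<lambda>w. v (\<zeta> * w)) has_derivative
      (\<lambda>h. \<zeta> powi m * (d_z v w * h + d_zbar v w * cnj h))) (at w)"
    by (rule has_derivative_transform_within_open[of _ _ _ _ "ball 0 1 - {0}"])
       (use w \<zeta> hom in \<open>auto simp: disc_homogeneous_def open_delete\<close>)
  then have "((\<lambda>w. v (\<zeta> * w)) has_derivative
      (\<lambda>h. (\<zeta> powi m * d_z v w) * h + (\<zeta> powi m * d_zbar v w) * cnj h)) (at w)"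
    by (simp add: algebra_simps)
  from wirtinger_unique(2)[OF this] wirtinger_unique(2)[OF D1']
  have "d_zbar v (\<zeta> * w) * cnj \<zeta> = \<zeta> powi m * d_zbar v w" by simp
  then have "d_zbar v (\<zeta> * w) * (\<zeta> * cnj \<zeta>) = \<zeta> * (\<zeta> powi m * d_zbar v w)"
    by (simp add: algebra_simps)
  then show "d_zbar v (\<zeta> * w) = \<zeta> powi (m + 1) * d_zbar v w"
    using \<zeta>0 by (simp add: \<zeta>c power_int_add algebra_simps)
qed

text \<open>The derivative of \<open>v\<close> along the circle through \<open>w\<close>, computed once by the chain rule and once
  from homogeneity.\<close>
lemma disc_homogeneous_angular_derivative:
  assumes hom: "disc_homogeneous m v" and diff: "v differentiable (at w)"
    and w: "w \<in> ball 0 1 - {0}"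
  shows "w * d_z v w - cnj w * d_zbar v w = of_int m * v w"
proof -
  have "(v has_derivative (\<lambda>h. d_z v w * h + d_zbar v w * cnj h)) (at (cis 0 * w))"
    using has_derivative_wirtinger[OF diff] by simp
  moreover have "((\<lambda>t. cis t * w) has_derivative (\<lambda>t. t *\<^sub>R (\<i> * w))) (at 0)"
    by (auto intro!: derivative_eq_intros simp: scaleR_conv_of_real)
  ultimately have "((\<lambda>t. v (cis t * w)) has_derivative
     (\<lambda>t. d_z v w * (t *\<^sub>R (\<i> * w)) + d_zbar v w * cnj (t *\<^sub>R (\<i> * w)))) (at 0)"
    by (rule has_derivative_compose[rotated])
  then have 1: "((\<lambda>t. v (cis t * w)) has_vector_derivative
      \<i> * (w * d_z v w - cnj w * d_zbar v w)) (at 0)"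
    unfolding has_vector_derivative_def
    by (rule has_derivative_eq_rhs) (auto simp: fun_eq_iff scaleR_conv_of_real algebra_simps)
  have "((\<lambda>t. cis (of_int m * t) * v w) has_vector_derivative \<i> * (of_int m * v w)) (at 0)"
    unfolding has_vector_derivative_def
    by (auto intro!: derivative_eq_intros simp: fun_eq_iff scaleR_conv_of_real algebra_simps)
  moreover have "v (cis t * w) = cis (of_int m * t) * v w" for t
    using hom w by (simp add: disc_homogeneous_def cis_power_int mult.commute)
  ultimately have "((\<lambda>t. v (cis t * w)) has_vector_derivative \<i> * (of_int m * v w)) (at 0)"
    by simp
  from vector_derivative_unique_at[OF 1 this] show ?thesis by simp
qed

section \<open>Uniqueness of homogeneous harmonic functions on the disc\<close>

lemma radial_derivative:
  assumes diff: "v differentiable (at (of_real r))"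
  shows "((\<lambda>t. v (of_real t)) has_vector_derivative d_z v (of_real r) + d_zbar v (of_real r)) (at r)"
proof -
  have "((\<lambda>t. of_real t :: complex) has_derivative of_real) (at r)"
    by (intro derivative_intros bounded_linear_imp_has_derivative bounded_linear_of_real)
  from has_derivative_compose[OF this has_derivative_wirtinger[OF diff]] show ?thesis
    unfolding has_vector_derivative_def
    by (rule has_derivative_eq_rhs) (auto simp: fun_eq_iff scaleR_conv_of_real algebra_simps)
qed

text \<open>The angular derivatives of \<open>v\<close> and \<open>d_zbar v\<close> express \<open>d_z v\<close> and \<open>d_zbar (d_zbar v)\<close>
  on the radius by lower-order terms; the equation \<open>L_disc a b v = 0\<close> then yields
  \<open>d_z (d_zbar v)\<close>. The trace of the resulting system is
  \<open>- 1 / r - 2 (a + b) r / (1 - r\<^sup>2)\<close>, independently of \<open>m\<close>.\<close>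
lemma disc_harmonic_radial_system:
  assumes harm: "disc_harmonic a b v" and hom: "disc_homogeneous m v" and r: "0 < r" "r < 1"
  shows "((\<lambda>t. v (of_real t)) has_vector_derivative
           of_int m / of_real r * v (of_real r) + 2 * d_zbar v (of_real r)) (at r)" (is ?g)
    and "((\<lambda>t. d_zbar v (of_real t)) has_vector_derivative
           - 2 * a * (of_int m - b) / of_real (1 - r\<^sup>2) * v (of_real r)
           + (- of_int (m + 1) / of_real r - 2 * (a + b) * of_real (r / (1 - r\<^sup>2)))
             * d_zbar v (of_real r)) (at r)" (is ?h)
proof -
  define R :: complex where "R = of_real r"
  define A B D g where defs: "A = d_z v R" "B = d_zbar v R" "D = d_z (d_zbar v) R" "g = v R"
  have R: "R \<in> ball 0 1 - {0}" "R \<noteq> 0" using r by (auto simp: R_def)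
  have r2: "1 - r\<^sup>2 \<noteq> 0" using r by (simp add: power2_eq_1_iff)
  then have R2: "1 - R\<^sup>2 \<noteq> 0" unfolding R_def
    by (metis of_real_1 of_real_diff of_real_eq_0_iff of_real_power)
  have dv: "v differentiable (at R)" and dh: "d_zbar v differentiable (at R)"
    and L: "L_disc a b v R = 0"
    using harm R by (auto simp: disc_harmonic_def)
  have "disc_homogeneous (m + 1) (d_zbar v)"
    using disc_homogeneous_d_zbar[OF hom] harm by (auto simp: disc_harmonic_def)
  note angular = disc_homogeneous_angular_derivative[OF hom dv R(1)]
    disc_homogeneous_angular_derivative[OF this dh R(1)]
  have cR: "cnj R = R" by (simp add: R_def)
  have A: "A = B + of_int m / R * g"
    using angular(1) R by (simp add: defs cR field_simps)
  have Dbar: "d_zbar (d_zbar v) R = D - of_int (m + 1) / R * B"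
    using angular(2) R by (simp add: defs cR field_simps)
  have "(1 - R\<^sup>2) * D + a * R * A + b * R * B - a * b * g = 0"
    using L r by (simp add: L_disc_def defs cR) (simp add: R_def)
  then have "(1 - R\<^sup>2) * D = - a * (of_int m - b) * g - (a + b) * (R * B)"
    using R unfolding A by (simp add: ring_distribs) (simp add: algebra_simps)
  then have D: "D = (- a * (of_int m - b) * g - (a + b) * (R * B)) / (1 - R\<^sup>2)"
    using R2 by (simp add: field_simps)
  show ?g
    using radial_derivative[of v r] dv A
    unfolding R_def[symmetric] defs[symmetric] by (simp add: algebra_simps)
  have "D + d_zbar (d_zbar v) R = - 2 * a * (of_int m - b) / (1 - R\<^sup>2) * g
           + (- of_int (m + 1) / R - 2 * (a + b) * (R / (1 - R\<^sup>2))) * B"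
    unfolding Dbar D using R R2 by (simp add: divide_simps) (simp add: algebra_simps)
  then show ?h
    using radial_derivative[of "d_zbar v" r] dh
    unfolding of_real_divide of_real_diff of_real_power of_real_1 R_def[symmetric] defs[symmetric]
    by simp
qed

lemma disc_harmonic_continuous:
  assumes "disc_harmonic a b v"
  shows "continuous_on (ball 0 1) v" "continuous_on (ball 0 1) (d_zbar v)"
  using assms
  by (auto simp: disc_harmonic_def intro!: continuous_at_imp_continuous_on differentiable_imp_continuous_within)

text \<open>The Wronskian of two solutions satisfies the scalar equation whose coefficient is the trace of the
  system. Multiplication by \<open>r\<close> cancels the term \<open>- 1 / r\<close> and produces a function that is
  continuous on \<open>[0,1)\<close> with value \<open>0\<close> at the centre, because \<open>v\<close> and \<open>d_zbar v\<close> are continuous on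
  the whole disc. This is how regularity at the centre selects a one-dimensional space of solutions.\<close>
lemma disc_harmonic_wronskian_zero:
  assumes harm: "disc_harmonic a b v1" "disc_harmonic a b v2"
    and hom: "disc_homogeneous m v1" "disc_homogeneous m v2" and r: "0 < r" "r < 1"
  shows "v1 (of_real r) * d_zbar v2 (of_real r) = v2 (of_real r) * d_zbar v1 (of_real r)"
proof -
  define P where "P = (\<lambda>t. of_real t * (v1 (of_real t) * d_zbar v2 (of_real t)
      - v2 (of_real t) * d_zbar v1 (of_real t)))"
  define q where "q = (\<lambda>t. - 2 * (a + b) * of_real (t / (1 - t\<^sup>2)))"
  have "P r = 0"
  proof (rule linear_differential_inequality_zero)
    show "continuous_on {0..r} P"
      unfolding P_def using r
      by (intro continuous_intros continuous_on_compose2[OF disc_harmonic_continuous(1)[OF harm(1)]]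
          continuous_on_compose2[OF disc_harmonic_continuous(1)[OF harm(2)]]
          continuous_on_compose2[OF disc_harmonic_continuous(2)[OF harm(1)]]
          continuous_on_compose2[OF disc_harmonic_continuous(2)[OF harm(2)]]) auto
    show "0 \<in> {0..r}" "P 0 = 0" "r \<in> {0..r}" using r by (auto simp: P_def)
    fix t assume "t \<in> {0<..<r}"
    then have t: "0 < t" "t < 1" "t < r" using r by auto
    define T :: complex where "T = of_real t"
    define g1 g2 h1 h2 where defs: "g1 = v1 T" "g2 = v2 T" "h1 = d_zbar v1 T" "h2 = d_zbar v2 T"
    \<comment> \<open>The two fractions in the system stay abbreviated: \<open>f\<close> cancels in the Wronskian, and \<open>e\<close> is a factor of \<open>q t\<close>.\<close>
    define e :: complex where "e = of_real (t / (1 - t\<^sup>2))"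
    define f where "f = - 2 * a * (of_int m - b) / of_real (1 - t\<^sup>2)"
    note D = disc_harmonic_radial_system[OF harm(1) hom(1) t(1,2)]
      disc_harmonic_radial_system[OF harm(2) hom(2) t(1,2)]
    have T: "T \<noteq> 0" using t by (simp add: T_def)
    have "(P has_vector_derivative q t * P t) (at t)"
      unfolding P_def
      by (rule has_vector_derivative_eq_rhs[OF has_vector_derivative_mult[OF
              has_vector_derivative_of_real[OF DERIV_ident]
              has_vector_derivative_diff[OF has_vector_derivative_mult[OF D(1) D(4)]
                has_vector_derivative_mult[OF D(3) D(2)]]]])
        (unfold T_def[symmetric] defs[symmetric] q_def e_def[symmetric] f_def[symmetric],
         use T in \<open>simp add: divide_simps, simp add: algebra_simps\<close>)
    then show "(P has_vector_derivative q t * P t) (at t)" .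
    have "t\<^sup>2 \<le> r\<^sup>2" "r\<^sup>2 < 1" using t r by (auto simp: power_mono power_less_one_iff)
    then have "t / (1 - t\<^sup>2) \<le> 1 / (1 - r\<^sup>2)" "0 \<le> t / (1 - t\<^sup>2)"
      using t by (auto intro!: frac_le divide_nonneg_nonneg power_le_one)
    then have "norm (q t) \<le> 2 * norm (a + b) * (1 / (1 - r\<^sup>2))"
      unfolding q_def norm_mult norm_of_real abs_of_nonneg[OF \<open>0 \<le> t / (1 - t\<^sup>2)\<close>]
      by (intro mult_mono) auto
    then show "norm (q t * P t) \<le> (2 * norm (a + b) * (1 / (1 - r\<^sup>2))) * norm (P t)"
      by (simp only: norm_mult) (intro mult_right_mono, auto)
  qed
  then show ?thesis using r by (simp add: P_def)
qed

text \<open>The multiple of \<open>v2\<close> that agrees with \<open>v1\<close> at radius \<open>r\<close> also has the same \<open>d_zbar\<close> there,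
  since the Wronskian vanishes. Hence their difference solves the radial system with zero initial
  values at \<open>r\<close> and vanishes on the whole radius; homogeneity spreads this over the punctured
  disc.\<close>
lemma disc_harmonic_homogeneous_proportional:
  assumes harm: "disc_harmonic a b v1" "disc_harmonic a b v2"
    and hom: "disc_homogeneous m v1" "disc_homogeneous m v2"
    and r: "0 < r" "r < 1" "v2 (of_real r) \<noteq> 0" and w: "w \<in> ball 0 1 - {0}"
  shows "v1 w = v1 (of_real r) / v2 (of_real r) * v2 w"
proof -
  define c1 c2 where c: "c1 = v1 (of_real r)" "c2 = v2 (of_real r)"
  define y where "y = (\<lambda>t::real. (c2 * v1 (of_real t) - c1 * v2 (of_real t),
      c2 * d_zbar v1 (of_real t) - c1 * d_zbar v2 (of_real t)))"
  define p11 :: "real \<Rightarrow> complex" where "p11 = (\<lambda>t. of_int m / of_real t)"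
  define p21 :: "real \<Rightarrow> complex" where "p21 = (\<lambda>t. - 2 * a * (of_int m - b) / of_real (1 - t\<^sup>2))"
  define p22 :: "real \<Rightarrow> complex" where
    "p22 = (\<lambda>t. - of_int (m + 1) / of_real t - 2 * (a + b) * of_real (t / (1 - t\<^sup>2)))"
  define y' where "y' = (\<lambda>t. (p11 t * fst (y t) + 2 * snd (y t), p21 t * fst (y t) + p22 t * snd (y t)))"
  have sub1: "1 - t\<^sup>2 \<noteq> 0" if "0 < t" "t < 1" for t :: real
    using that by (simp add: power2_eq_1_iff)
  have y_der: "(y has_vector_derivative y' t) (at t)" if t: "0 < t" "t < 1" for t
  proof -
    have p: "of_int m / of_real t = p11 t"
      "- 2 * a * (of_int m - b) / of_real (1 - t\<^sup>2) = p21 t"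
      "- of_int (m + 1) / of_real t - 2 * (a + b) * of_real (t / (1 - t\<^sup>2)) = p22 t"
      by (simp_all add: p11_def p21_def p22_def)
    note D = disc_harmonic_radial_system[OF harm(1) hom(1) t, unfolded p]
      disc_harmonic_radial_system[OF harm(2) hom(2) t, unfolded p]
    show ?thesis
      unfolding y_def
      by (rule has_vector_derivative_eq_rhs[OF has_vector_derivative_Pair[OF
              has_vector_derivative_diff[OF has_vector_derivative_mult_right[OF D(1)]
                has_vector_derivative_mult_right[OF D(3)]]
              has_vector_derivative_diff[OF has_vector_derivative_mult_right[OF D(2)]
                has_vector_derivative_mult_right[OF D(4)]]]])
        (simp add: y'_def y_def algebra_simps)
  qed
  have yr: "y r = 0"
    using disc_harmonic_wronskian_zero[OF harm hom r(1,2)] by (simp add: y_def c zero_prod_def)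
  have y0: "y s = 0" if s: "0 < s" "s < 1" for s
  proof -
    define I where "I = {min r s..max r s}"
    have I: "0 < t \<and> t < 1" if "t \<in> I" for t using that r s by (auto simp: I_def)
    \<comment> \<open>The interval between \<open>r\<close> and \<open>s\<close> stays away from both singular points, so the coefficients are bounded on it.\<close>
    define N where "N = (\<lambda>t. norm (p11 t) + 2 + norm (p21 t) + norm (p22 t))"
    have "continuous_on I N"
      unfolding N_def p11_def p21_def p22_def
      by (intro continuous_intros) (use I sub1 in \<open>fastforce simp del: of_real_diff of_real_power\<close>)+
    then have "compact (N ` I)"
      by (intro compact_continuous_image) (auto simp: I_def)
    then obtain K where K: "\<And>t. t \<in> I \<Longrightarrow> norm (N t) \<le> K"
      by (meson bounded_iff compact_imp_bounded imageI)
    show "y s = 0"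
    proof (rule linear_differential_inequality_zero[where a = "min r s" and b = "max r s" and y' = y'])
      show "continuous_on {min r s..max r s} y"
        by (intro continuous_at_imp_continuous_on ballI has_vector_derivative_continuous[OF y_der])
          (use I in \<open>auto simp: I_def\<close>)
      show "r \<in> {min r s..max r s}" "y r = 0" "s \<in> {min r s..max r s}" using yr by auto
      fix t assume "t \<in> {min r s<..<max r s}"
      then have t: "t \<in> I" by (auto simp: I_def)
      show "(y has_vector_derivative y' t) (at t)" using I[OF t] y_der by blast
      have f: "norm (fst (y t)) \<le> norm (y t)" and s: "norm (snd (y t)) \<le> norm (y t)"
        by (metis norm_fst_le prod.collapse, metis norm_snd_le prod.collapse)
      have "norm (y' t) \<le> norm (p11 t * fst (y t) + 2 * snd (y t)) + norm (p21 t * fst (y t) + p22 t * snd (y t))"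
        unfolding y'_def by (rule norm_Pair_le)
      also have "\<dots> \<le> (norm (p11 t) * norm (fst (y t)) + 2 * norm (snd (y t)))
          + (norm (p21 t) * norm (fst (y t)) + norm (p22 t) * norm (snd (y t)))"
        by (intro add_mono norm_triangle_le) (auto simp: norm_mult)
      also have "\<dots> \<le> (norm (p11 t) * norm (y t) + 2 * norm (y t))
          + (norm (p21 t) * norm (y t) + norm (p22 t) * norm (y t))"
        by (intro add_mono mult_left_mono f s) auto
      also have "\<dots> = N t * norm (y t)" by (simp add: N_def algebra_simps)
      also have "\<dots> \<le> K * norm (y t)" using K[OF t] by (intro mult_right_mono) auto
      finally show "norm (y' t) \<le> K * norm (y t)" .
    qed
  qed
  define s where "s = cmod w"
  have s: "0 < s" "s < 1" using w by (auto simp: s_def)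
  have \<zeta>: "cmod (sgn w) = 1" using w by (simp add: norm_sgn)
  have wS: "w = sgn w * of_real s"
    using w by (simp add: s_def sgn_div_norm scaleR_conv_of_real)
  have S: "of_real s \<in> ball (0::complex) 1 - {0}" using s by auto
  have "v1 w = sgn w powi m * v1 (of_real s)" "v2 w = sgn w powi m * v2 (of_real s)"
    using hom S \<zeta> by (auto simp: disc_homogeneous_def intro: arg_cong[OF wS, of v1, THEN trans] arg_cong[OF wS, of v2, THEN trans])
  moreover have "c2 * v1 (of_real s) = c1 * v2 (of_real s)"
    using y0[OF s] by (simp add: y_def zero_prod_def)
  ultimately show ?thesis
    using r(3) by (simp add: c field_simps)
qed

section \<open>The hypergeometric solution\<close>

lemma hypergeo_F_altdef:
  "hypergeo_F a b c x = (\<Sum>k. (pochhammer a k * pochhammer b k / (pochhammer c k * fact k)) * x ^ k)"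
  by (simp add: hypergeo_F_def field_simps)

text \<open>The two-term recurrence of the coefficients is the hypergeometric equation read off at one power
  of \<open>x\<close>; it also gives the ratio of consecutive terms.\<close>
lemma hypergeo_coeff_Suc:
  fixes a b c :: complex
  assumes "\<And>k. c + of_nat k \<noteq> 0"
  shows "(c + of_nat k) * of_nat (Suc k) * (pochhammer a (Suc k) * pochhammer b (Suc k) / (pochhammer c (Suc k) * fact (Suc k)))
    = (a + of_nat k) * (b + of_nat k) * (pochhammer a k * pochhammer b k / (pochhammer c k * fact k))"
proof -
  have "of_nat (Suc k) \<noteq> (0::complex)" by (rule of_nat_neq_0)
  moreover have "pochhammer c k \<noteq> 0"
  proof
    assume "pochhammer c k = 0"
    then obtain j where "c = - of_nat j" by (auto simp: pochhammer_eq_0_iff)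
    with assms[of j] show False by simp
  qed
  ultimately show ?thesis using assms[of k]
    by (simp add: pochhammer_Suc divide_simps del: of_nat_Suc)
qed

lemma tendsto_shifted_index_ratio:
  "(\<lambda>k. (a + of_nat k) / of_nat (Suc k) :: complex) \<longlonglongrightarrow> 1"
proof -
  have "(\<lambda>k. 1 + (a - 1) / of_nat (Suc k) :: complex) \<longlonglongrightarrow> 1 + 0"
    by (intro tendsto_intros tendsto_divide_0[OF tendsto_const]
        filterlim_compose[OF tendsto_of_nat filterlim_Suc])
  moreover have "1 + (a - 1) / of_nat (Suc k) = (a + of_nat k) / of_nat (Suc k)" for k
    using of_nat_neq_0[of k, where 'a = complex] by (simp add: divide_simps)
  ultimately show ?thesis by simp
qed

lemma summable_hypergeo:
  fixes a b c :: complex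
  assumes c: "\<And>k. c + of_nat k \<noteq> 0" and x: "norm x < 1"
  shows "summable (\<lambda>k. (pochhammer a k * pochhammer b k / (pochhammer c k * fact k)) * x ^ k)"
proof -
  define A where "A = (\<lambda>k. pochhammer a k * pochhammer b k / (pochhammer c k * fact k))"
  define \<rho> where "\<rho> = (\<lambda>k. (a + of_nat k) * (b + of_nat k) / ((c + of_nat k) * of_nat (Suc k)))"
  have "(\<lambda>k. (a + of_nat k) / of_nat (Suc k) * ((b + of_nat k) / of_nat (Suc k))
       / ((c + of_nat k) / of_nat (Suc k))) \<longlonglongrightarrow> 1 * 1 / 1"
    by (intro tendsto_intros tendsto_shifted_index_ratio) simp
  moreover have "(a + of_nat k) / of_nat (Suc k) * ((b + of_nat k) / of_nat (Suc k))
       / ((c + of_nat k) / of_nat (Suc k)) = \<rho> k" for k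
    using of_nat_neq_0[of k, where 'a = complex] c[of k]
    unfolding \<rho>_def by (simp add: divide_simps del: of_nat_Suc)
  ultimately have "\<rho> \<longlonglongrightarrow> 1" by simp
  then have "(\<lambda>k. norm (\<rho> k * x)) \<longlonglongrightarrow> norm (1 * x)" by (intro tendsto_intros)
  then have "\<forall>\<^sub>F k in sequentially. norm (\<rho> k * x) < (1 + norm x) / 2"
    by (rule order_tendstoD) (use x in simp)
  then obtain N where N: "\<And>k. k \<ge> N \<Longrightarrow> norm (\<rho> k * x) < (1 + norm x) / 2"
    by (auto simp: eventually_sequentially)
  have "summable (\<lambda>k. A k * x ^ k)"
  proof (rule summable_ratio_test)
    show "(1 + norm x) / 2 < 1" using x by simp
    fix k assume k: "N \<le> k"
    have "(c + of_nat k) * of_nat (Suc k) * A (Suc k) = (a + of_nat k) * (b + of_nat k) * A k"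
      unfolding A_def by (rule hypergeo_coeff_Suc[OF c])
    then have "A (Suc k) = \<rho> k * A k"
      using of_nat_neq_0[of k, where 'a = complex] c[of k]
      unfolding \<rho>_def by (simp add: divide_simps mult.commute del: of_nat_Suc)
    then have "norm (A (Suc k) * x ^ Suc k) = norm (\<rho> k * x) * norm (A k * x ^ k)"
      by (simp add: norm_mult mult_ac)
    also have "\<dots> \<le> (1 + norm x) / 2 * norm (A k * x ^ k)"
      using N[OF k] by (intro mult_right_mono) auto
    finally show "norm (A (Suc k) * x ^ Suc k) \<le> (1 + norm x) / 2 * norm (A k * x ^ k)" .
  qed
  then show ?thesis by (simp add: A_def)
qed

lemma sums_times_variable:
  fixes x :: "'a::{real_normed_field,banach}"
  assumes "(\<lambda>n. e n * x ^ n) sums S"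
  shows "(\<lambda>n. (case n of 0 \<Rightarrow> 0 | Suc k \<Rightarrow> e k) * x ^ n) sums (x * S)"
proof (subst sums_Suc_iff[where s = "x * S" and f = "\<lambda>n. (case n of 0 \<Rightarrow> 0 | Suc k \<Rightarrow> e k) * x ^ n", simplified, symmetric])
  show "(\<lambda>n. e n * (x * x ^ n)) sums (x * S)"
    using sums_mult[OF assms, of x] by (simp add: mult_ac)
qed

text \<open>Three derivatives are provided: the second one occurs in the equation, and the third one shows that
  the second is continuous.\<close>
theorem hypergeo_F_differential_equation:
  assumes c: "\<And>k. c + of_nat k \<noteq> 0"
  obtains F' F'' F''' where
    "\<And>x. norm x < 1 \<Longrightarrow> (hypergeo_F a b c has_field_derivative F' x) (at x)"
    "\<And>x. norm x < 1 \<Longrightarrow> (F' has_field_derivative F'' x) (at x)"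
    "\<And>x. norm x < 1 \<Longrightarrow> (F'' has_field_derivative F''' x) (at x)"
    "\<And>x. norm x < 1 \<Longrightarrow>
       x * (1 - x) * F'' x + (c - (a + b + 1) * x) * F' x - a * b * hypergeo_F a b c x = 0"
proof -
  define A where "A = (\<lambda>k. pochhammer a k * pochhammer b k / (pochhammer c k * fact k))"
  have A_Suc: "(c + of_nat k) * of_nat (Suc k) * A (Suc k) = (a + of_nat k) * (b + of_nat k) * A k" for k
    unfolding A_def by (rule hypergeo_coeff_Suc[OF c])
  have F: "hypergeo_F a b c = (\<lambda>x. \<Sum>k. A k * x ^ k)"
    by (simp add: fun_eq_iff hypergeo_F_altdef A_def)
  have sm0: "summable (\<lambda>k. A k * x ^ k)" if "norm x < 1" for x
    unfolding A_def by (rule summable_hypergeo[OF c that])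
  have sm1: "summable (\<lambda>k. diffs A k * x ^ k)" if "norm x < 1" for x
    by (rule termdiff_converges[OF that sm0])
  have sm2: "summable (\<lambda>k. diffs (diffs A) k * x ^ k)" if "norm x < 1" for x
    by (rule termdiff_converges[OF that sm1])
  show thesis
  proof (rule that)
    fix x :: complex assume x: "norm x < 1"
    show "(hypergeo_F a b c has_field_derivative (\<Sum>k. diffs A k * x ^ k)) (at x)"
      unfolding F by (rule termdiffs_strong'[OF sm0 x])
    show "((\<lambda>x. \<Sum>k. diffs A k * x ^ k) has_field_derivative (\<Sum>k. diffs (diffs A) k * x ^ k)) (at x)"
      by (rule termdiffs_strong'[OF sm1 x])
    show "((\<lambda>x. \<Sum>k. diffs (diffs A) k * x ^ k) has_field_derivative
        (\<Sum>k. diffs (diffs (diffs A)) k * x ^ k)) (at x)"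
      by (rule termdiffs_strong'[OF sm2 x])
    define S0 S1 S2 where S: "S0 = (\<Sum>k. A k * x ^ k)" "S1 = (\<Sum>k. diffs A k * x ^ k)"
      "S2 = (\<Sum>k. diffs (diffs A) k * x ^ k)"
    have s0: "(\<lambda>k. A k * x ^ k) sums S0" and s1: "(\<lambda>k. diffs A k * x ^ k) sums S1"
      and s2: "(\<lambda>k. diffs (diffs A) k * x ^ k) sums S2"
      using sm0[OF x] sm1[OF x] sm2[OF x] by (auto simp: S summable_sums)
    note xs1 = sums_times_variable[OF s1]
    note xs2 = sums_times_variable[OF s2]
    note xxs2 = sums_times_variable[OF xs2]
    have "(\<lambda>n. 0) sums (x * S2 - x * (x * S2) + c * S1 - (a + b + 1) * (x * S1) - a * b * S0)"
    proof (rule sums_cong[THEN iffD1, rotated])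
      show "(\<lambda>n. (case n of 0 \<Rightarrow> 0 | Suc k \<Rightarrow> diffs (diffs A) k) * x ^ n
         - (case n of 0 \<Rightarrow> 0 | Suc k \<Rightarrow> (case k of 0 \<Rightarrow> 0 | Suc k \<Rightarrow> diffs (diffs A) k)) * x ^ n
         + c * (diffs A n * x ^ n)
         - (a + b + 1) * ((case n of 0 \<Rightarrow> 0 | Suc k \<Rightarrow> diffs A k) * x ^ n)
         - a * b * (A n * x ^ n)) sums
         (x * S2 - x * (x * S2) + c * S1 - (a + b + 1) * (x * S1) - a * b * S0)"
        by (intro sums_add sums_diff sums_mult xs1 xs2 xxs2 s0 s1)
      fix n
      \<comment> \<open>Multiplying by \<open>x\<close> shifts the coefficients; this turns the terms of the equation into polynomials in \<open>n\<close> times coefficients of \<open>F\<close>.\<close>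
      have theta1: "(case n of 0 \<Rightarrow> 0 | Suc k \<Rightarrow> diffs A k) = of_nat n * A n"
        by (cases n) (auto simp: diffs_def)
      have theta2: "(case n of 0 \<Rightarrow> 0 | Suc k \<Rightarrow> diffs (diffs A) k) = of_nat n * of_nat (Suc n) * A (Suc n)"
        by (cases n) (auto simp: diffs_def)
      have theta3: "(case n of 0 \<Rightarrow> 0 | Suc k \<Rightarrow> (case k of 0 \<Rightarrow> 0 | Suc k \<Rightarrow> diffs (diffs A) k))
          = of_nat n * (of_nat n - 1) * A n"
        by (cases n; cases "n - 1") (auto simp: diffs_def algebra_simps)
      have "(c + of_nat n) * of_nat (Suc n) * A (Suc n) * x ^ n
          - (a + of_nat n) * (b + of_nat n) * A n * x ^ n = 0"
        by (simp only: A_Suc diff_self)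
      then show "(case n of 0 \<Rightarrow> 0 | Suc k \<Rightarrow> diffs (diffs A) k) * x ^ n
         - (case n of 0 \<Rightarrow> 0 | Suc k \<Rightarrow> (case k of 0 \<Rightarrow> 0 | Suc k \<Rightarrow> diffs (diffs A) k)) * x ^ n
         + c * (diffs A n * x ^ n)
         - (a + b + 1) * ((case n of 0 \<Rightarrow> 0 | Suc k \<Rightarrow> diffs A k) * x ^ n)
         - a * b * (A n * x ^ n) = 0"
        unfolding theta1 theta2 theta3 unfolding diffs_def by (simp add: algebra_simps)
    qed
    then have "x * S2 - x * (x * S2) + c * S1 - (a + b + 1) * (x * S1) - a * b * S0 = 0"
      by (rule sums_unique2[OF _ sums_zero])
    then show "x * (1 - x) * (\<Sum>k. diffs (diffs A) k * x ^ k) + (c - (a + b + 1) * x) * (\<Sum>k. diffs A k * x ^ k)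
        - a * b * hypergeo_F a b c x = 0"
      unfolding F S[symmetric] by (simp add: algebra_simps)
  qed
qed

text \<open>The exponents \<open>p - 1\<close> and \<open>q - 1\<close> come with the factors \<open>p\<close> and \<open>q\<close>, so the formula
  remains correct when the subtraction is truncated.\<close>
lemma wirtinger_radial_monomial:
  assumes "(f has_field_derivative f') (at (w * cnj w))"
  shows "((\<lambda>w. f (w * cnj w) * w ^ p * cnj w ^ q) has_derivative
     (\<lambda>h. (f' * w ^ p * cnj w ^ Suc q + of_nat p * f (w * cnj w) * w ^ (p - 1) * cnj w ^ q) * h
        + (f' * w ^ Suc p * cnj w ^ q + of_nat q * f (w * cnj w) * w ^ p * cnj w ^ (q - 1)) * cnj h)) (at w)"
proof -
  have 1: "((\<lambda>w. w * cnj w) has_derivative (\<lambda>h. w * cnj h + h * cnj w)) (at w)"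
    by (auto intro!: derivative_eq_intros)
  have "((\<lambda>w. f (w * cnj w)) has_derivative (\<lambda>h. f' * (w * cnj h + h * cnj w))) (at w)"
    using has_derivative_compose[OF 1 assms[unfolded has_field_derivative_def]] .
  note D = this
  show ?thesis
    by (rule has_derivative_eq_rhs[OF has_derivative_mult[OF has_derivative_mult[OF D
            has_derivative_power[OF has_derivative_ident]]
            has_derivative_power[OF has_derivative_cnj[OF has_derivative_ident]]]])
       (simp add: fun_eq_iff algebra_simps)
qed

definition hypergeo_mode :: "complex \<Rightarrow> complex \<Rightarrow> int \<Rightarrow> complex \<Rightarrow> complex" where
  "hypergeo_mode a b m w =
     hypergeo_F (of_int (pos_part m) - b) (of_int (neg_part m) - a)
       (of_int (pos_part m + neg_part m + 1)) (of_real ((cmod w)\<^sup>2))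
     * w powi pos_part m * cnj w powi neg_part m"

lemma hypergeo_mode_eq:
  fixes p q :: nat
  assumes "p = 0 \<or> q = 0"
  shows "hypergeo_mode a b (int p - int q) w =
     hypergeo_F (of_nat p - b) (of_nat q - a) (of_nat (p + q + 1)) (w * cnj w) * w ^ p * cnj w ^ q"
proof -
  have "pos_part (int p - int q) = int p" "neg_part (int p - int q) = int q"
    using assms by (auto simp: pos_part_def neg_part_def)
  moreover have "of_int (int p + int q + 1) = (of_nat (p + q + 1) :: complex)"
    by simp
  ultimately show ?thesis
    by (simp only: hypergeo_mode_def complex_norm_square of_int_of_nat_eq power_int_of_nat)
qed

lemma int_split_obtain:
  obtains p q :: nat where "m = int p - int q" "p = 0 \<or> q = 0"
  by (cases m rule: int_cases2) force+

text \<open>A mode in the form that is convenient for differentiation: with natural exponents and with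
  \<open>w * cnj w\<close> as the argument of a function with complex derivatives.\<close>
lemma hypergeo_mode_profile:
  obtains p q :: nat and F F' F'' F''' :: "complex \<Rightarrow> complex" where
    "m = int p - int q" "p = 0 \<or> q = 0" "F 0 = 1"
    "\<And>w. hypergeo_mode a b m w = F (w * cnj w) * w ^ p * cnj w ^ q"
    "\<And>x. norm x < 1 \<Longrightarrow> (F has_field_derivative F' x) (at x)"
    "\<And>x. norm x < 1 \<Longrightarrow> (F' has_field_derivative F'' x) (at x)"
    "\<And>x. norm x < 1 \<Longrightarrow> (F'' has_field_derivative F''' x) (at x)"
    "\<And>x. norm x < 1 \<Longrightarrow> x * (1 - x) * F'' x
        + (of_nat (p + q + 1) - (of_nat p - b + (of_nat q - a) + 1) * x) * F' x
        - (of_nat p - b) * (of_nat q - a) * F x = 0"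
proof -
  obtain p q :: nat where m: "m = int p - int q" "p = 0 \<or> q = 0" by (rule int_split_obtain)
  define F where "F = hypergeo_F (of_nat p - b) (of_nat q - a) (of_nat (p + q + 1))"
  have "of_nat (p + q + 1) + of_nat k \<noteq> (0 :: complex)" for k
    unfolding of_nat_add[symmetric] of_nat_eq_0_iff by simp
  then obtain F' F'' F''' where
    "\<And>x. norm x < 1 \<Longrightarrow> (F has_field_derivative F' x) (at x)"
    "\<And>x. norm x < 1 \<Longrightarrow> (F' has_field_derivative F'' x) (at x)"
    "\<And>x. norm x < 1 \<Longrightarrow> (F'' has_field_derivative F''' x) (at x)"
    "\<And>x. norm x < 1 \<Longrightarrow> x * (1 - x) * F'' x
        + (of_nat (p + q + 1) - (of_nat p - b + (of_nat q - a) + 1) * x) * F' x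
        - (of_nat p - b) * (of_nat q - a) * F x = 0"
    unfolding F_def
    by (rule hypergeo_F_differential_equation[of "of_nat (p + q + 1)" "of_nat p - b" "of_nat q - a"])
       (rule that[unfolded F_def])
  moreover have "F 0 = 1" unfolding F_def hypergeo_F_altdef powser_zero by simp
  moreover have "hypergeo_mode a b m w = F (w * cnj w) * w ^ p * cnj w ^ q" for w
    unfolding m(1) hypergeo_mode_eq[OF m(2)] F_def ..
  ultimately show thesis by (intro that[OF m])
qed

lemma disc_homogeneous_hypergeo_mode: "disc_homogeneous m (hypergeo_mode a b m)"
proof -
  obtain p q :: nat and F where m: "m = int p - int q"
    and mode: "\<And>w. hypergeo_mode a b m w = F (w * cnj w) * w ^ p * cnj w ^ q"
    by (rule hypergeo_mode_profile[of m a b]) (rule that)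
  show ?thesis
    unfolding disc_homogeneous_def
  proof (intro ballI allI impI)
    fix w \<zeta> :: complex assume \<zeta>: "cmod \<zeta> = 1"
    have \<zeta>0: "\<zeta> \<noteq> 0" and \<zeta>c: "\<zeta> * cnj \<zeta> = 1"
      using \<zeta> by (auto simp: complex_norm_square[symmetric])
    have pow: "\<zeta> ^ p * cnj \<zeta> ^ q = \<zeta> powi m"
    proof -
      have "cnj \<zeta> = inverse \<zeta>" using \<zeta>c \<zeta>0 by (simp add: field_simps)
      then show ?thesis using \<zeta>0 m by (simp add: power_int_diff power_inverse divide_inverse)
    qed
    have "\<zeta> * w * cnj (\<zeta> * w) = w * cnj w" using \<zeta>c by (simp add: mult_ac)
    then have 1: "F (\<zeta> * w * cnj (\<zeta> * w)) = F (w * cnj w)" by (simp only:)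
    have "F (\<zeta> * w * cnj (\<zeta> * w)) * (\<zeta> * w) ^ p * cnj (\<zeta> * w) ^ q
        = \<zeta> powi m * (F (w * cnj w) * w ^ p * cnj w ^ q)"
      unfolding 1 pow[symmetric] by (simp add: power_mult_distrib mult_ac)
    then show "hypergeo_mode a b m (\<zeta> * w) = \<zeta> powi m * hypergeo_mode a b m w"
      unfolding mode .
  qed
qed

text \<open>With \<open>x = w * cnj w\<close>, each term of \<open>L_disc a b\<close> applied to \<open>F(x) w\<^sup>p (cnj w)\<^sup>q\<close> is a function of
  \<open>x\<close> times \<open>w\<^sup>p (cnj w)\<^sup>q\<close>. Because \<open>p q = 0\<close>, the sum of these functions is the left-hand side of the
  hypergeometric equation with parameters \<open>p - b\<close>, \<open>q - a\<close> and \<open>p + q + 1\<close>.\<close>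
lemma disc_harmonic_hypergeo_mode: "disc_harmonic a b (hypergeo_mode a b m)"
proof -
  obtain p q :: nat and F F' F'' where m: "p = 0 \<or> q = 0"
    and mode: "\<And>w. hypergeo_mode a b m w = F (w * cnj w) * w ^ p * cnj w ^ q"
    and F: "\<And>x. norm x < 1 \<Longrightarrow> (F has_field_derivative F' x) (at x)"
      "\<And>x. norm x < 1 \<Longrightarrow> (F' has_field_derivative F'' x) (at x)"
      "\<And>x. norm x < 1 \<Longrightarrow> x * (1 - x) * F'' x
        + (of_nat (p + q + 1) - (of_nat p - b + (of_nat q - a) + 1) * x) * F' x
        - (of_nat p - b) * (of_nat q - a) * F x = 0"
    by (rule hypergeo_mode_profile[of m a b]) (rule that)
  define c :: complex where "c = of_nat (p + q + 1)"
  define G where "G = hypergeo_mode a b m"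
  have G: "G = (\<lambda>w. F (w * cnj w) * w ^ p * cnj w ^ q)"
    unfolding G_def by (simp add: fun_eq_iff mode)
  define H where "H = (\<lambda>w. F' (w * cnj w) * w ^ Suc p * cnj w ^ q
      + of_nat q * (F (w * cnj w) * w ^ p * cnj w ^ (q - 1)))"
  have small: "norm (w * cnj w) < 1" if "w \<in> ball 0 1" for w :: complex
    using that by (simp add: norm_mult power2_eq_square[symmetric] power_less_one_iff)
  note DG = wirtinger_radial_monomial[OF F(1)[OF small], of _ p q, folded G]
  have dG: "d_z G w = F' (w * cnj w) * w ^ p * cnj w ^ Suc q + of_nat p * F (w * cnj w) * w ^ (p - 1) * cnj w ^ q"
    "d_zbar G w = H w" if "w \<in> ball 0 1" for w
    using wirtinger_unique[OF DG[OF that]] by (auto simp: H_def mult_ac)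
  have DH: "(H has_derivative (\<lambda>h.
      (F'' (w * cnj w) * w ^ Suc p * cnj w ^ Suc q + of_nat (Suc p) * F' (w * cnj w) * w ^ p * cnj w ^ q
       + of_nat q * (F' (w * cnj w) * w ^ p * cnj w ^ Suc (q - 1)
             + of_nat p * F (w * cnj w) * w ^ (p - 1) * cnj w ^ (q - 1))) * h
     + (F'' (w * cnj w) * w ^ Suc (Suc p) * cnj w ^ q + of_nat q * F' (w * cnj w) * w ^ Suc p * cnj w ^ (q - 1)
       + of_nat q * (F' (w * cnj w) * w ^ Suc p * cnj w ^ (q - 1)
             + of_nat (q - 1) * F (w * cnj w) * w ^ p * cnj w ^ (q - 1 - 1))) * cnj h)) (at w)"
    if "w \<in> ball 0 1" for w
    unfolding H_def
    by (rule has_derivative_eq_rhs[OF has_derivative_add[OF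
          wirtinger_radial_monomial[OF F(2)[OF small[OF that]], of "Suc p" q]
          has_derivative_mult_right[OF wirtinger_radial_monomial[OF F(1)[OF small[OF that]], of p "q - 1"]]]])
       (simp add: fun_eq_iff algebra_simps)
  have DH': "(d_zbar G has_derivative D) (at w)" if "w \<in> ball 0 1" "(H has_derivative D) (at w)" for w D
    by (rule has_derivative_transform_within_open[OF that(2) open_ball that(1)]) (simp add: dG)
  have "L_disc a b G w = 0" if w: "w \<in> ball 0 1" for w
  proof -
    define x where "x = w * cnj w"
    note ode = F(3)[OF small[OF w], folded x_def c_def]
    have sq: "of_real ((cmod w)\<^sup>2) = x" by (simp only: x_def complex_norm_square)
    have dH: "d_z (d_zbar G) w = F'' x * w ^ Suc p * cnj w ^ Suc q + of_nat (Suc p) * F' x * w ^ p * cnj w ^ q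
       + of_nat q * (F' x * w ^ p * cnj w ^ Suc (q - 1) + of_nat p * F x * w ^ (p - 1) * cnj w ^ (q - 1))"
      using wirtinger_unique(1)[OF DH'[OF w DH[OF w]]] by (simp only: x_def)
    have 1: "d_z (d_zbar G) w = (x * F'' x + c * F' x) * w ^ p * cnj w ^ q"
      unfolding dH using m by (cases q) (auto simp: x_def c_def algebra_simps)
    have 2: "w * d_z G w = (x * F' x + of_nat p * F x) * w ^ p * cnj w ^ q"
      unfolding dG(1)[OF w] by (cases p) (auto simp: x_def algebra_simps)
    have 3: "cnj w * d_zbar G w = (x * F' x + of_nat q * F x) * w ^ p * cnj w ^ q"
      unfolding dG(2)[OF w] H_def by (cases q) (auto simp: x_def algebra_simps)
    have 4: "G w = F x * w ^ p * cnj w ^ q" by (simp add: G x_def)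
    have pq: "of_nat p * of_nat q = (0::complex)" using m by auto
    have "L_disc a b G w = ((1 - x) * (x * F'' x + c * F' x) + a * (x * F' x + of_nat p * F x)
        + b * (x * F' x + of_nat q * F x) - a * b * F x) * (w ^ p * cnj w ^ q)"
      unfolding L_disc_def sq mult.assoc 1[unfolded mult.assoc] 2[unfolded mult.assoc] 3[unfolded mult.assoc] 4
      by (simp add: algebra_simps)
    also have "(1 - x) * (x * F'' x + c * F' x) + a * (x * F' x + of_nat p * F x)
        + b * (x * F' x + of_nat q * F x) - a * b * F x
       = x * (1 - x) * F'' x + (c - (of_nat p - b + (of_nat q - a) + 1) * x) * F' x
         - (of_nat p - b) * (of_nat q - a) * F x + of_nat p * of_nat q * F x"
      by (simp add: c_def algebra_simps)
    finally show ?thesis by (simp add: ode pq)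
  qed
  moreover have "G differentiable (at w)" "d_zbar G differentiable (at w)" if "w \<in> ball 0 1" for w
    using DG[OF that] DH'[OF that DH[OF that]] by (auto simp: differentiable_def)
  ultimately show ?thesis unfolding disc_harmonic_def G_def by blast
qed

text \<open>Near the centre, the hypergeometric factor is close to \<open>1\<close>, so the mode behaves like a
  monomial.\<close>
lemma hypergeo_mode_nonzero:
  obtains r where "0 < r" "r < 1" "hypergeo_mode a b m (of_real r) \<noteq> 0"
proof -
  obtain p q :: nat and F F' where
    mode: "\<And>w. hypergeo_mode a b m w = F (w * cnj w) * w ^ p * cnj w ^ q" and "F 0 = 1"
    and F': "\<And>x. norm x < 1 \<Longrightarrow> (F has_field_derivative F' x) (at x)"
    by (rule hypergeo_mode_profile[of m a b]) (rule that)
  have cont: "isCont F (of_real (0 * 0))" using DERIV_isCont[OF F'[of 0]] by simp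
  have "isCont (\<lambda>r. F (of_real (r * r))) 0"
    by (rule isCont_o2[where f = "\<lambda>r. of_real (r * r)" and g = F, OF _ cont]) (intro continuous_intros)
  with \<open>F 0 = 1\<close> have "((\<lambda>r. F (of_real (r * r))) \<longlongrightarrow> 1) (at_right 0)"
    by (auto simp: isCont_def intro: tendsto_mono[OF at_le])
  then have "\<forall>\<^sub>F r in at_right 0. F (of_real (r * r)) \<noteq> 0"
    by (rule tendsto_imp_eventually_ne) simp
  moreover have "\<forall>\<^sub>F r :: real in at_right 0. 0 < r \<and> r < 1"
    by (auto simp: eventually_at_right_field intro: exI[of _ 1])
  ultimately have "\<forall>\<^sub>F r in at_right 0. F (of_real (r * r)) \<noteq> 0 \<and> 0 < r \<and> r < 1"
    by eventually_elim auto
  then obtain r where "F (of_real (r * r)) \<noteq> 0" "0 < r" "r < 1"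
    using eventually_happens'[of "at_right (0::real)"] by auto
  then show thesis
    by (intro that[of r]) (auto simp: mode)
qed

section \<open>Twice continuously differentiable functions\<close>

text \<open>A function is twice continuously differentiable if it has a derivative that is continuously
  differentiable as a function into the space of bounded linear maps. So the closure properties of
  \<open>C2_on\<close> follow from those of \<open>C1_on\<close> for functions with values in that space, where the derivatives
  are assembled by composition of linear maps, a bounded bilinear operation.\<close>
definition C1_on :: "'a::real_normed_vector set \<Rightarrow> ('a \<Rightarrow> 'b::real_normed_vector) \<Rightarrow> bool" where
  "C1_on S f \<longleftrightarrow> (\<exists>f' :: 'a \<Rightarrow> 'a \<Rightarrow>\<^sub>L 'b.
     (\<forall>z\<in>S. (f has_derivative blinfun_apply (f' z)) (at z)) \<and> continuous_on S f')"

lemma C2_on_iff_C1_on: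
  "C2_on S u \<longleftrightarrow>
     (\<exists>u' :: _ \<Rightarrow> _ \<Rightarrow>\<^sub>L _. (\<forall>z\<in>S. (u has_derivative blinfun_apply (u' z)) (at z)) \<and> C1_on S u')"
  unfolding C2_on_def C1_on_def by blast

lemma C1_onI:
  fixes f' :: "_ \<Rightarrow> _ \<Rightarrow>\<^sub>L _"
  assumes "\<And>z. z \<in> S \<Longrightarrow> (f has_derivative blinfun_apply (f' z)) (at z)" "continuous_on S f'"
  shows "C1_on S f"
  unfolding C1_on_def using assms by (intro exI[of _ f'] conjI ballI)

lemma C2_onI:
  fixes u' :: "_ \<Rightarrow> _ \<Rightarrow>\<^sub>L _"
  assumes "\<And>z. z \<in> S \<Longrightarrow> (u has_derivative blinfun_apply (u' z)) (at z)" "C1_on S u'"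
  shows "C2_on S u"
  unfolding C2_on_iff_C1_on using assms by (intro exI[of _ u'] conjI ballI)

lemma C1_on_continuous: "C1_on S f \<Longrightarrow> continuous_on S f"
  unfolding C1_on_def
  by (meson continuous_at_imp_continuous_on has_derivative_continuous)

lemma C2_on_imp_C1_on: "C2_on S f \<Longrightarrow> C1_on S f"
  unfolding C2_on_iff_C1_on using C1_on_continuous unfolding C1_on_def by blast

lemma bounded_linear_Blinfun_bilinear:
  assumes "bounded_bilinear B"
  shows "bounded_linear (\<lambda>x. Blinfun (B x))"
proof -
  interpret bounded_bilinear B by fact
  have app: "blinfun_apply (Blinfun (B x)) = B x" for x
    by (rule bounded_linear_Blinfun_apply[OF bounded_linear_right])
  obtain K where K: "0 < K" "\<And>x y. norm (B x y) \<le> norm x * norm y * K" using pos_bounded by blast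
  show ?thesis
  proof (rule bounded_linear_intro[where K = K])
    show "Blinfun (B (x + y)) = Blinfun (B x) + Blinfun (B y)" for x y
      by (rule blinfun_eqI) (simp add: app blinfun.add_left add_left)
    show "Blinfun (B (r *\<^sub>R x)) = r *\<^sub>R Blinfun (B x)" for r x
      by (rule blinfun_eqI) (simp add: app blinfun.scaleR_left scaleR_left)
    show "norm (Blinfun (B x)) \<le> norm x * K" for x
      by (rule norm_blinfun_bound) (use K in \<open>auto simp: app mult_ac\<close>)
  qed
qed

lemma C1_on_const: "C1_on S (\<lambda>z. c)"
  unfolding C1_on_def by (rule exI[of _ "\<lambda>z. 0"]) (auto intro!: derivative_eq_intros)

lemma C1_on_add:
  assumes "C1_on S f" "C1_on S g"
  shows "C1_on S (\<lambda>z. f z + g z)"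
proof -
  obtain f' g' where "\<forall>z\<in>S. (f has_derivative blinfun_apply (f' z)) (at z)" "continuous_on S f'"
    "\<forall>z\<in>S. (g has_derivative blinfun_apply (g' z)) (at z)" "continuous_on S g'"
    using assms unfolding C1_on_def by blast
  then show ?thesis
    unfolding C1_on_def
    by (intro exI[of _ "\<lambda>z. f' z + g' z"])
       (auto simp: plus_blinfun.rep_eq intro!: has_derivative_add continuous_intros)
qed

lemma C1_on_bounded_linear:
  assumes L: "bounded_linear L" and f: "C1_on S f"
  shows "C1_on S (\<lambda>z. L (f z))"
proof -
  obtain f' where f': "\<forall>z\<in>S. (f has_derivative blinfun_apply (f' z)) (at z)" "continuous_on S f'"
    using f unfolding C1_on_def by blast
  have "((\<lambda>z. L (f z)) has_derivative blinfun_apply (Blinfun L o\<^sub>L f' z)) (at z)" if "z \<in> S" for z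
    by (rule has_derivative_eq_rhs[OF bounded_linear.has_derivative[OF L f'(1)[rule_format, OF that]]])
       (simp add: fun_eq_iff bounded_linear_Blinfun_apply[OF L])
  moreover have "continuous_on S (\<lambda>z. Blinfun L o\<^sub>L f' z)"
    by (intro bounded_bilinear.continuous_on[OF bounded_bilinear_blinfun_compose] f' continuous_on_const)
  ultimately show ?thesis by (rule C1_onI)
qed

lemma C1_on_bounded_bilinear:
  assumes B: "bounded_bilinear B" and f: "C1_on S f" and g: "C1_on S g"
  shows "C1_on S (\<lambda>z. B (f z) (g z))"
proof -
  obtain f' where f': "\<forall>z\<in>S. (f has_derivative blinfun_apply (f' z)) (at z)" "continuous_on S f'"
    using f unfolding C1_on_def by blast
  obtain g' where g': "\<forall>z\<in>S. (g has_derivative blinfun_apply (g' z)) (at z)" "continuous_on S g'"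
    using g unfolding C1_on_def by blast
  have L: "bounded_linear (\<lambda>x. Blinfun (B x))" and R: "bounded_linear (\<lambda>y. Blinfun (\<lambda>x. B x y))"
    using bounded_linear_Blinfun_bilinear B bounded_bilinear.flip[OF B] by blast+
  define D where "D = (\<lambda>z. (Blinfun (B (f z)) o\<^sub>L g' z) + (Blinfun (\<lambda>x. B x (g z)) o\<^sub>L f' z))"
  have "((\<lambda>z. B (f z) (g z)) has_derivative blinfun_apply (D z)) (at z)" if "z \<in> S" for z
    by (rule has_derivative_eq_rhs[OF bounded_bilinear.FDERIV[OF B
            f'(1)[rule_format, OF that] g'(1)[rule_format, OF that]]])
       (simp add: fun_eq_iff D_def plus_blinfun.rep_eq
          bounded_linear_Blinfun_apply[OF bounded_bilinear.bounded_linear_right[OF B]]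
          bounded_linear_Blinfun_apply[OF bounded_bilinear.bounded_linear_left[OF B]])
  moreover have "continuous_on S D"
    unfolding D_def
    by (intro continuous_on_add bounded_bilinear.continuous_on[OF bounded_bilinear_blinfun_compose]
        bounded_linear.continuous_on[OF L] bounded_linear.continuous_on[OF R] f' g' C1_on_continuous f g)
  ultimately show ?thesis by (rule C1_onI)
qed

lemma C1_on_holomorphic_compose:
  fixes F :: "complex \<Rightarrow> complex"
  assumes g: "C1_on S g" and F: "\<And>z. z \<in> S \<Longrightarrow> (F has_field_derivative F' (g z)) (at (g z))"
    and cont: "\<And>z. z \<in> S \<Longrightarrow> isCont F' (g z)"
  shows "C1_on S (\<lambda>z. F (g z))"
proof -
  obtain g' where g': "\<forall>z\<in>S. (g has_derivative blinfun_apply (g' z)) (at z)" "continuous_on S g'"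
    using g unfolding C1_on_def by blast
  have "((\<lambda>z. F (g z)) has_derivative blinfun_apply (blinfun_mult_right (F' (g z)) o\<^sub>L g' z)) (at z)"
    if "z \<in> S" for z
    by (rule has_derivative_eq_rhs[OF has_derivative_compose[OF g'(1)[rule_format, OF that]
            F[OF that, unfolded has_field_derivative_def]]]) (simp add: fun_eq_iff)
  moreover have "continuous_on S (\<lambda>z. F' (g z))"
  proof (intro continuous_at_imp_continuous_on ballI)
    fix z assume z: "z \<in> S"
    then have "isCont g z" using g' has_derivative_continuous by blast
    then show "isCont (\<lambda>z. F' (g z)) z" by (rule isCont_o2) (rule cont[OF z])
  qed
  then have "continuous_on S (\<lambda>z. blinfun_mult_right (F' (g z)) o\<^sub>L g' z)"
    by (intro bounded_bilinear.continuous_on[OF bounded_bilinear_blinfun_compose] g'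
        bounded_linear.continuous_on[OF bounded_linear_blinfun_mult_right])
  ultimately show ?thesis by (rule C1_onI)
qed

lemma C2_on_const: "C2_on S (\<lambda>z. c)"
  unfolding C2_on_iff_C1_on
  by (rule exI[of _ "\<lambda>z. 0"]) (auto intro!: derivative_eq_intros C1_on_const)

lemma C2_on_bounded_linear: "bounded_linear L \<Longrightarrow> C2_on S L"
  unfolding C2_on_iff_C1_on
  by (rule exI[of _ "\<lambda>z. Blinfun L"])
     (simp add: bounded_linear_Blinfun_apply bounded_linear_imp_has_derivative C1_on_const)

lemma C2_on_mult:
  fixes f g :: "'a::real_normed_vector \<Rightarrow> complex"
  assumes f: "C2_on S f" and g: "C2_on S g"
  shows "C2_on S (\<lambda>z. f z * g z)"
proof -
  obtain f' where f': "\<forall>z\<in>S. (f has_derivative blinfun_apply (f' z)) (at z)" "C1_on S f'"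
    using f unfolding C2_on_iff_C1_on by blast
  obtain g' where g': "\<forall>z\<in>S. (g has_derivative blinfun_apply (g' z)) (at z)" "C1_on S g'"
    using g unfolding C2_on_iff_C1_on by blast
  define D where "D = (\<lambda>z. (blinfun_mult_right (f z) o\<^sub>L g' z) + (blinfun_mult_left (g z) o\<^sub>L f' z))"
  have "((\<lambda>z. f z * g z) has_derivative blinfun_apply (D z)) (at z)" if "z \<in> S" for z
    by (rule has_derivative_eq_rhs[OF has_derivative_mult[OF
            f'(1)[rule_format, OF that] g'(1)[rule_format, OF that]]])
       (simp add: fun_eq_iff D_def plus_blinfun.rep_eq)
  moreover have "C1_on S D"
    unfolding D_def
    by (intro C1_on_add C1_on_bounded_bilinear[OF bounded_bilinear_blinfun_compose]
        C1_on_bounded_linear[OF bounded_linear_blinfun_mult_right]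
        C1_on_bounded_linear[OF bounded_linear_blinfun_mult_left] f' g' C2_on_imp_C1_on f g)
  ultimately show ?thesis by (rule C2_onI)
qed

lemma C2_on_power:
  fixes f :: "'a::real_normed_vector \<Rightarrow> complex"
  shows "C2_on S f \<Longrightarrow> C2_on S (\<lambda>z. f z ^ n)"
  by (induction n) (auto intro: C2_on_const C2_on_mult)

lemma C2_on_prod:
  fixes f :: "'i \<Rightarrow> 'a::real_normed_vector \<Rightarrow> complex"
  assumes "\<And>i. i \<in> I \<Longrightarrow> C2_on S (f i)"
  shows "C2_on S (\<lambda>z. \<Prod>i\<in>I. f i z)"
  using assms by (induction I rule: infinite_finite_induct) (auto intro: C2_on_const C2_on_mult)

lemma C2_on_holomorphic_compose:
  fixes F :: "complex \<Rightarrow> complex"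
  assumes g: "C2_on S g" and F: "\<And>z. z \<in> S \<Longrightarrow> (F has_field_derivative F' (g z)) (at (g z))"
    and F': "\<And>z. z \<in> S \<Longrightarrow> (F' has_field_derivative F'' (g z)) (at (g z))"
    and F'': "\<And>z. z \<in> S \<Longrightarrow> isCont F'' (g z)"
  shows "C2_on S (\<lambda>z. F (g z))"
proof -
  obtain g' where g': "\<forall>z\<in>S. (g has_derivative blinfun_apply (g' z)) (at z)" "C1_on S g'"
    using g unfolding C2_on_iff_C1_on by blast
  have "((\<lambda>z. F (g z)) has_derivative blinfun_apply (blinfun_mult_right (F' (g z)) o\<^sub>L g' z)) (at z)"
    if "z \<in> S" for z
    by (rule has_derivative_eq_rhs[OF has_derivative_compose[OF g'(1)[rule_format, OF that]
            F[OF that, unfolded has_field_derivative_def]]]) (simp add: fun_eq_iff)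
  moreover have "C1_on S (\<lambda>z. blinfun_mult_right (F' (g z)) o\<^sub>L g' z)"
    by (intro C1_on_bounded_bilinear[OF bounded_bilinear_blinfun_compose] g'(2)
        C1_on_bounded_linear[OF bounded_linear_blinfun_mult_right]
        C1_on_holomorphic_compose[OF C2_on_imp_C1_on[OF g] F' F''])
  ultimately show ?thesis by (rule C2_onI)
qed

lemma C2_on_cong_open:
  assumes "open S" "\<And>z. z \<in> S \<Longrightarrow> f z = g z" "C2_on S f"
  shows "C2_on S g"
  using assms(3) unfolding C2_on_iff_C1_on
  by (meson assms(1,2) has_derivative_transform_within_open)

lemma open_polydisc: "open (polydisc :: (complex ^ 'n) set)"
proof -
  have "polydisc = (\<Inter>j::'n. {z. cmod (z $ j) < 1})" by (auto simp: polydisc_def)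
  moreover have "open (\<Inter>j::'n. {z :: complex ^ 'n. cmod (z $ j) < 1})"
    by (intro open_INT ballI open_Collect_less continuous_intros) auto
  ultimately show ?thesis by simp
qed

lemma C2_on_hypergeo_mode: "C2_on polydisc (\<lambda>z. hypergeo_mode a b m (z $ j))"
proof -
  obtain p q :: nat and F F' F'' F''' where
    mode: "\<And>w. hypergeo_mode a b m w = F (w * cnj w) * w ^ p * cnj w ^ q"
    and F: "\<And>x. norm x < 1 \<Longrightarrow> (F has_field_derivative F' x) (at x)"
      "\<And>x. norm x < 1 \<Longrightarrow> (F' has_field_derivative F'' x) (at x)"
      "\<And>x. norm x < 1 \<Longrightarrow> (F'' has_field_derivative F''' x) (at x)"
    by (rule hypergeo_mode_profile[of m a b]) (rule that)
  have z: "C2_on polydisc (\<lambda>z. z $ j)"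
    by (rule C2_on_bounded_linear) (rule bounded_linear_vec_nth)
  have cz: "C2_on polydisc (\<lambda>z. cnj (z $ j))"
    by (rule C2_on_bounded_linear) (intro bounded_linear_compose[OF bounded_linear_cnj] bounded_linear_vec_nth)
  have "norm (z $ j * cnj (z $ j)) < 1" if "z \<in> polydisc" for z
    using that by (simp add: polydisc_def norm_mult power2_eq_square[symmetric] power_less_one_iff)
  then have "C2_on polydisc (\<lambda>z. F (z $ j * cnj (z $ j)))"
    by (intro C2_on_holomorphic_compose[where F' = F' and F'' = F'', OF C2_on_mult[OF z cz]]
        F(1,2) DERIV_isCont[OF F(3)])
  then show ?thesis
    unfolding mode by (intro C2_on_mult C2_on_power z cz)
qed

section \<open>Slices in one variable\<close>

definition set_coord :: "'n \<Rightarrow> 'a \<Rightarrow> 'a ^ 'n \<Rightarrow> 'a ^ 'n" where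
  "set_coord j w z = (\<chi> i. if i = j then w else z $ i)"

lemma set_coord_nth [simp]: "set_coord j w z $ i = (if i = j then w else z $ i)"
  by (simp add: set_coord_def)

lemma set_coord_self [simp]: "set_coord j (z $ j) z = z"
  by (simp add: vec_eq_iff)

lemma set_coord_polydisc: "z \<in> polydisc \<Longrightarrow> w \<in> ball 0 1 \<Longrightarrow> set_coord j w z \<in> polydisc"
  by (auto simp: polydisc_def)

lemma has_derivative_set_coord:
  fixes j :: "'n::finite"
  shows "((\<lambda>w::complex. set_coord j w z) has_derivative axis j) (at w)"
proof -
  have eq: "(\<lambda>w. set_coord j w z) = (\<lambda>w. set_coord j 0 z + axis j w)"
    by (auto simp: fun_eq_iff vec_eq_iff axis_def)
  have "bounded_linear (axis j :: complex \<Rightarrow> complex ^ 'n)"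
    by (intro linear_conv_bounded_linear[THEN iffD1] linearI) (auto simp: vec_eq_iff axis_def)
  then show ?thesis
    unfolding eq
    by (rule has_derivative_eq_rhs[OF has_derivative_add[OF has_derivative_const
            bounded_linear_imp_has_derivative]]) simp
qed

text \<open>The vector \<open>axis j h\<close> is the derivative of \<open>set_coord j w z\<close> in \<open>w\<close>, so the partial derivatives
  in the \<open>j\<close>-th coordinate are the Wirtinger derivatives of the slice.\<close>
lemma slice_wirtinger:
  assumes "u differentiable (at (set_coord j w z))"
  shows "(\<lambda>w. u (set_coord j w z)) differentiable (at w)"
    and "d_z (\<lambda>w. u (set_coord j w z)) w = partial_z j u (set_coord j w z)"
    and "d_zbar (\<lambda>w. u (set_coord j w z)) w = partial_zbar j u (set_coord j w z)"
proof -
  define D where "D = frechet_derivative u (at (set_coord j w z))"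
  have "(u has_derivative D) (at (set_coord j w z))"
    unfolding D_def using assms frechet_derivative_works by blast
  from has_derivative_compose[OF has_derivative_set_coord this]
  have D: "((\<lambda>w. u (set_coord j w z)) has_derivative (\<lambda>h. D (axis j h))) (at w)" .
  show "(\<lambda>w. u (set_coord j w z)) differentiable (at w)"
    using D by (auto simp: differentiable_def)
  show "d_z (\<lambda>w. u (set_coord j w z)) w = partial_z j u (set_coord j w z)"
    "d_zbar (\<lambda>w. u (set_coord j w z)) w = partial_zbar j u (set_coord j w z)"
    unfolding d_z_def d_zbar_def partial_z_def partial_zbar_def partial_x_def partial_y_def
      frechet_derivative_at[OF D, symmetric] D_def by auto
qed

lemma C2_on_differentiable:
  assumes "C2_on polydisc u" "z \<in> polydisc"
  shows "u differentiable (at z)" "partial_zbar j u differentiable (at z)"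
proof -
  obtain u' u'' where u: "\<forall>z\<in>polydisc. (u has_derivative blinfun_apply (u' z)) (at z)"
    "\<forall>z\<in>polydisc. (u' has_derivative blinfun_apply (u'' z)) (at z)"
    using assms(1) unfolding C2_on_def by blast
  show "u differentiable (at z)" using u(1) assms(2) by (auto simp: differentiable_def)
  have eq: "(blinfun_apply (u' x) (axis j 1) + \<i> * blinfun_apply (u' x) (axis j \<i>)) / 2 = partial_zbar j u x"
    if "x \<in> polydisc" for x
    using frechet_derivative_at[OF u(1)[rule_format, OF that]]
    by (simp add: partial_zbar_def partial_x_def partial_y_def)
  have ap: "((\<lambda>x. blinfun_apply (u' x) h) has_derivative (\<lambda>k. blinfun_apply (blinfun_apply (u'' z) k) h)) (at z)" for h
    using bounded_linear.has_derivative[OF blinfun.bounded_linear_left u(2)[rule_format, OF assms(2)]] .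
  have "((\<lambda>x. (blinfun_apply (u' x) (axis j 1) + \<i> * blinfun_apply (u' x) (axis j \<i>)) / 2)
      has_derivative (\<lambda>k. (blinfun_apply (blinfun_apply (u'' z) k) (axis j 1)
         + \<i> * blinfun_apply (blinfun_apply (u'' z) k) (axis j \<i>)) / 2)) (at z)"
    by (rule has_derivative_eq_rhs[OF bounded_linear.has_derivative[OF bounded_linear_divide
          has_derivative_add[OF ap has_derivative_mult_right[OF ap]]]]) simp
  then have "(partial_zbar j u has_derivative (\<lambda>k. (blinfun_apply (blinfun_apply (u'' z) k) (axis j 1)
         + \<i> * blinfun_apply (blinfun_apply (u'' z) k) (axis j \<i>)) / 2)) (at z)"
    by (rule has_derivative_transform_within_open[OF _ open_polydisc assms(2)]) (rule eq)
  then show "partial_zbar j u differentiable (at z)" by (auto simp: differentiable_def)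
qed

lemma slice_L_op:
  assumes u: "C2_on polydisc u" and z: "z \<in> polydisc" and w: "w \<in> ball 0 1"
  shows "(\<lambda>w. u (set_coord j w z)) differentiable (at w)"
    and "d_zbar (\<lambda>w. u (set_coord j w z)) differentiable (at w)"
    and "L_disc a b (\<lambda>w. u (set_coord j w z)) w = L_op a b j u (set_coord j w z)"
proof -
  have in_poly: "set_coord j x z \<in> polydisc" if "x \<in> ball 0 1" for x
    by (rule set_coord_polydisc[OF z that])
  note S = slice_wirtinger[OF C2_on_differentiable(1)[OF u in_poly]]
  note T = slice_wirtinger[OF C2_on_differentiable(2)[OF u in_poly[OF w]]]
  have eq: "partial_zbar j u (set_coord j x z) = d_zbar (\<lambda>w. u (set_coord j w z)) x"
    if "x \<in> ball 0 1" for x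
    using S(3)[OF that] by simp
  note C = wirtinger_cong[where g = "d_zbar (\<lambda>w. u (set_coord j w z))", OF open_ball w eq T(1)]
  have dd: "d_z (d_zbar (\<lambda>w. u (set_coord j w z))) w = partial_z j (partial_zbar j u) (set_coord j w z)"
    by (rule trans[OF C(2) T(2)])
  show "(\<lambda>w. u (set_coord j w z)) differentiable (at w)" by (rule S(1)[OF w])
  show "d_zbar (\<lambda>w. u (set_coord j w z)) differentiable (at w)" by (rule C(1))
  show "L_disc a b (\<lambda>w. u (set_coord j w z)) w = L_op a b j u (set_coord j w z)"
    by (simp only: L_disc_def L_op_def dd S(2)[OF w] S(3)[OF w] set_coord_nth simp_thms if_True)
qed

text \<open>Apart from the smoothness of \<open>u\<close> as a whole, separate harmonicity is a statement about functions
  on the disc.\<close>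
lemma sep_harmonic_iff_slices:
  "u \<in> sep_harmonic \<alpha> \<beta> \<longleftrightarrow> C2_on polydisc u \<and>
     (\<forall>j. \<forall>z\<in>polydisc. disc_harmonic (\<alpha> $ j) (\<beta> $ j) (\<lambda>w. u (set_coord j w z)))"
proof (intro iffI conjI)
  assume u: "u \<in> sep_harmonic \<alpha> \<beta>"
  then show C: "C2_on polydisc u" by (simp add: sep_harmonic_def)
  show "\<forall>j. \<forall>z\<in>polydisc. disc_harmonic (\<alpha> $ j) (\<beta> $ j) (\<lambda>w. u (set_coord j w z))"
    unfolding disc_harmonic_def
  proof (intro allI ballI conjI)
    fix j :: 'a and z :: "complex ^ 'a" and w :: complex assume zw: "z \<in> polydisc" "w \<in> ball (0 :: complex) 1"
    show "(\<lambda>w. u (set_coord j w z)) differentiable (at w)"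
      "d_zbar (\<lambda>w. u (set_coord j w z)) differentiable (at w)"
      using slice_L_op[OF C zw] by blast+
    show "L_disc (\<alpha> $ j) (\<beta> $ j) (\<lambda>w. u (set_coord j w z)) w = 0"
      using u set_coord_polydisc[OF zw] unfolding slice_L_op(3)[OF C zw] sep_harmonic_def by blast
  qed
next
  assume *: "C2_on polydisc u \<and>
     (\<forall>j. \<forall>z\<in>polydisc. disc_harmonic (\<alpha> $ j) (\<beta> $ j) (\<lambda>w. u (set_coord j w z)))"
  have "L_op (\<alpha> $ j) (\<beta> $ j) j u z = 0" if z: "z \<in> polydisc" for j z
  proof -
    have "z $ j \<in> ball 0 1" using z by (simp add: polydisc_def)
    with * z slice_L_op(3)[of u z "z $ j" "\<alpha> $ j" "\<beta> $ j" j] show ?thesis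
      by (auto simp: disc_harmonic_def)
  qed
  with * show "u \<in> sep_harmonic \<alpha> \<beta>" by (simp add: sep_harmonic_def)
qed

lemma mode_product_sep_harmonic:
  fixes \<alpha> \<beta> :: "complex ^ 'n"
  assumes u: "\<And>z. z \<in> polydisc \<Longrightarrow> u z = c * (\<Prod>j\<in>UNIV. hypergeo_mode (\<alpha> $ j) (\<beta> $ j) (m $ j) (z $ j))"
  shows "u \<in> sep_harmonic \<alpha> \<beta>"
  unfolding sep_harmonic_iff_slices
proof (intro conjI allI ballI)
  let ?M = "\<lambda>j. hypergeo_mode (\<alpha> $ j) (\<beta> $ j) (m $ j)"
  show "C2_on polydisc u"
    by (rule C2_on_cong_open[OF open_polydisc u[symmetric]])
       (auto intro!: C2_on_mult C2_on_const C2_on_prod C2_on_hypergeo_mode)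
  fix j and z :: "complex ^ 'n" assume z: "z \<in> polydisc"
  show "disc_harmonic (\<alpha> $ j) (\<beta> $ j) (\<lambda>w. u (set_coord j w z))"
  proof (rule disc_harmonic_cong_scale[OF disc_harmonic_hypergeo_mode])
    fix w :: complex assume "w \<in> ball 0 1"
    from set_coord_polydisc[OF z this, of j]
    have "u (set_coord j w z) = c * (\<Prod>i\<in>UNIV. ?M i (set_coord j w z $ i))"
      by (rule u)
    also have "(\<Prod>i\<in>UNIV. ?M i (set_coord j w z $ i)) = ?M j w * (\<Prod>i\<in>UNIV - {j}. ?M i (z $ i))"
      by (subst prod.remove[of _ j]) auto
    finally show "u (set_coord j w z) = (c * (\<Prod>i\<in>UNIV - {j}. ?M i (z $ i))) * ?M j w"
      by simp
  qed
qed

lemma polydisc0_iff: "z \<in> polydisc0 \<longleftrightarrow> (\<forall>j. z $ j \<in> ball 0 1 - {0})"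
  by (auto simp: polydisc0_def polydisc_def)

lemma mode_product_homogeneous:
  fixes \<alpha> \<beta> :: "complex ^ 'n"
  assumes u: "\<And>z. z \<in> polydisc \<Longrightarrow> u z = c * (\<Prod>j\<in>UNIV. hypergeo_mode (\<alpha> $ j) (\<beta> $ j) (m $ j) (z $ j))"
  shows "homogeneous m u"
  unfolding homogeneous_def
proof (intro conjI ballI)
  have "C2_on polydisc u" using mode_product_sep_harmonic[OF u] by (simp add: sep_harmonic_def)
  then have "continuous_on polydisc u" by (intro C1_on_continuous C2_on_imp_C1_on)
  then show "continuous_on polydisc0 u"
    by (rule continuous_on_subset) (auto simp: polydisc0_def)
  fix z \<zeta> :: "complex ^ 'n" assume z: "z \<in> polydisc0" and \<zeta>: "\<zeta> \<in> torus"
  have in_poly: "z \<in> polydisc" "(\<chi> j. \<zeta> $ j * z $ j) \<in> polydisc"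
    using z \<zeta> by (auto simp: polydisc0_def polydisc_def torus_def norm_mult)
  have "hypergeo_mode (\<alpha> $ j) (\<beta> $ j) (m $ j) (\<zeta> $ j * z $ j)
      = \<zeta> $ j powi (m $ j) * hypergeo_mode (\<alpha> $ j) (\<beta> $ j) (m $ j) (z $ j)" for j
    using z \<zeta> disc_homogeneous_hypergeo_mode[of "m $ j" "\<alpha> $ j" "\<beta> $ j"]
    by (auto simp: disc_homogeneous_def polydisc0_iff torus_def)
  then show "u (\<chi> j. \<zeta> $ j * z $ j) = (\<Prod>j\<in>UNIV. \<zeta> $ j powi (m $ j)) * u z"
    using u[OF in_poly(1)] u[OF in_poly(2)] by (simp add: prod.distrib)
qed

lemma homogeneous_slice:
  assumes u: "homogeneous m u" and z: "z \<in> polydisc0"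
  shows "disc_homogeneous (m $ j) (\<lambda>w. u (set_coord j w z))"
  unfolding disc_homogeneous_def
proof (intro ballI allI impI)
  fix w \<zeta> :: complex assume w: "w \<in> ball 0 1 - {0}" and \<zeta>: "cmod \<zeta> = 1"
  have "set_coord j w z \<in> polydisc0" using z w by (auto simp: polydisc0_iff)
  moreover have "set_coord j \<zeta> (\<chi> i. 1) \<in> torus" using \<zeta> by (auto simp: torus_def)
  ultimately have "u (\<chi> i. set_coord j \<zeta> (\<chi> i. 1) $ i * set_coord j w z $ i)
      = (\<Prod>i\<in>UNIV. set_coord j \<zeta> (\<chi> i. 1) $ i powi (m $ i)) * u (set_coord j w z)"
    using u unfolding homogeneous_def by blast
  moreover have "(\<chi> i. set_coord j \<zeta> (\<chi> i. 1) $ i * set_coord j w z $ i) = set_coord j (\<zeta> * w) z"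
    by (simp add: vec_eq_iff)
  moreover have "(\<Prod>i\<in>UNIV. set_coord j \<zeta> (\<chi> i. 1) $ i powi (m $ i)) = \<zeta> powi (m $ j)"
    by (subst prod.remove[of _ j]) auto
  ultimately show "u (set_coord j (\<zeta> * w) z) = \<zeta> powi (m $ j) * u (set_coord j w z)" by simp
qed

text \<open>Every point of the polydisc is the limit of points off the coordinate hyperplanes: replace the
  vanishing coordinates by a small positive number.\<close>
lemma eq_on_polydisc_if_eq_on_polydisc0:
  fixes f g :: "complex ^ 'n \<Rightarrow> complex"
  assumes f: "continuous_on polydisc f" and g: "continuous_on polydisc g"
    and eq: "\<And>z. z \<in> polydisc0 \<Longrightarrow> f z = g z" and z: "z \<in> polydisc"
  shows "f z = g z"
proof -
  define \<gamma> :: "real \<Rightarrow> complex ^ 'n" where "\<gamma> = (\<lambda>t. \<chi> i. if z $ i = 0 then of_real t else z $ i)"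
  have "((\<lambda>t. \<gamma> t $ i) \<longlongrightarrow> z $ i) (at_right 0)" for i
    by (cases "z $ i = 0") (auto simp: \<gamma>_def intro!: tendsto_eq_intros)
  then have lim: "(\<gamma> \<longlongrightarrow> z) (at_right 0)" by (rule vec_tendstoI)
  have "isCont f z" "isCont g z"
    using f g z continuous_on_eq_continuous_at[OF open_polydisc] by blast+
  then have lim_fg: "((\<lambda>t. f (\<gamma> t)) \<longlongrightarrow> f z) (at_right 0)" "((\<lambda>t. g (\<gamma> t)) \<longlongrightarrow> g z) (at_right 0)"
    using lim by (auto intro: isCont_tendsto_compose)
  have "\<forall>\<^sub>F t :: real in at_right 0. 0 < t \<and> t < 1"
    by (auto simp: eventually_at_right_field intro: exI[of _ 1])
  then have "\<forall>\<^sub>F t in at_right 0. f (\<gamma> t) = g (\<gamma> t)"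
  proof eventually_elim
    case (elim t)
    then show ?case using z by (intro eq) (auto simp: \<gamma>_def polydisc0_iff polydisc_def)
  qed
  from Lim_transform_eventually[OF lim_fg(1) this] lim_fg(2) show ?thesis
    by (rule tendsto_unique[OF trivial_limit_at_right_real])
qed

section \<open>Separation of variables\<close>

text \<open>Proportionality in the slices moves the coordinates, one at a time, to fixed radii \<open>r j\<close> where the
  modes do not vanish. What remains in the end is the value of \<open>u\<close> at one point, which gives the
  constant.\<close>
lemma homogeneous_sep_harmonic_is_mode_product:
  fixes \<alpha> \<beta> :: "complex ^ 'n"
  assumes u: "u \<in> sep_harmonic \<alpha> \<beta>" and hom: "homogeneous m u"
  shows "\<exists>c. \<forall>z\<in>polydisc. u z = c * (\<Prod>j\<in>UNIV. hypergeo_mode (\<alpha> $ j) (\<beta> $ j) (m $ j) (z $ j))"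
proof -
  let ?M = "\<lambda>j. hypergeo_mode (\<alpha> $ j) (\<beta> $ j) (m $ j)"
  have "\<forall>j. \<exists>r. 0 < r \<and> r < 1 \<and> ?M j (of_real r) \<noteq> 0"
    using hypergeo_mode_nonzero by metis
  then obtain r where r: "\<And>j. 0 < r j" "\<And>j. r j < 1" "\<And>j. ?M j (of_real (r j)) \<noteq> 0"
    by metis
  have step: "u z = (\<Prod>j\<in>S. ?M j (z $ j) / ?M j (of_real (r j)))
      * u (\<chi> i. if i \<in> S then of_real (r i) else z $ i)"
    if "finite S" and z: "z \<in> polydisc0" for S z
    using \<open>finite S\<close>
  proof induction
    case empty
    then show ?case by simp
  next
    case (insert j S)
    define y :: "complex ^ 'n" where "y = (\<chi> i. if i \<in> S then of_real (r i) else z $ i)"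
    have y: "y \<in> polydisc0" "y \<in> polydisc"
      using z r less_imp_neq[OF r(1)] by (auto simp: y_def polydisc0_iff polydisc_def abs_of_pos)
    have "disc_harmonic (\<alpha> $ j) (\<beta> $ j) (\<lambda>w. u (set_coord j w y))"
      using u y by (simp add: sep_harmonic_iff_slices)
    from disc_harmonic_homogeneous_proportional[OF this disc_harmonic_hypergeo_mode
        homogeneous_slice[OF hom y(1)] disc_homogeneous_hypergeo_mode r(1-3)]
    have "u (set_coord j (z $ j) y) = u (set_coord j (of_real (r j)) y) / ?M j (of_real (r j)) * ?M j (z $ j)"
      using z by (simp add: polydisc0_iff)
    moreover have "set_coord j (z $ j) y = y"
      using insert.hyps by (simp add: vec_eq_iff y_def)
    moreover have "set_coord j (of_real (r j)) y = (\<chi> i. if i \<in> insert j S then of_real (r i) else z $ i)"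
      by (simp add: vec_eq_iff y_def)
    ultimately show ?case
      using insert by (simp add: y_def mult_ac)
  qed
  define c where "c = u (\<chi> i. of_real (r i)) / (\<Prod>j\<in>UNIV. ?M j (of_real (r j)))"
  have on0: "u z = c * (\<Prod>j\<in>UNIV. ?M j (z $ j))" if "z \<in> polydisc0" for z
    using step[of UNIV z] that by (simp add: c_def prod_dividef)
  have "continuous_on polydisc u"
    using u by (intro C1_on_continuous C2_on_imp_C1_on) (simp add: sep_harmonic_def)
  moreover have "continuous_on polydisc (\<lambda>z. c * (\<Prod>j\<in>UNIV. ?M j (z $ j)))"
    by (intro C1_on_continuous C2_on_imp_C1_on C2_on_mult C2_on_const C2_on_prod C2_on_hypergeo_mode)
  ultimately have "u z = c * (\<Prod>j\<in>UNIV. ?M j (z $ j))" if "z \<in> polydisc" for z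
    by (rule eq_on_polydisc_if_eq_on_polydisc0[where f = u
          and g = "\<lambda>z. c * (\<Prod>j\<in>UNIV. ?M j (z $ j))", OF _ _ on0 that])
  then show ?thesis by blast
qed

theorem proposition2p15:
  fixes \<alpha> \<beta> :: "complex ^ 'n"
  assumes "\<forall>j. Re (\<alpha> $ j) + Re (\<beta> $ j) > -1"
    and "\<forall>j. \<alpha> $ j \<notin> {- of_nat k | k. k \<ge> 1} \<and> \<beta> $ j \<notin> {- of_nat k | k. k \<ge> 1}"
  shows
    "(\<forall>(u :: complex ^ 'n \<Rightarrow> complex) (m :: int ^ 'n).
        u \<in> sep_harmonic \<alpha> \<beta> \<and> homogeneous m u \<longrightarrow>
        (\<exists>c. \<forall>z\<in>polydisc. u z =
           c * (\<Prod>j\<in>UNIV.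
             hypergeo_F (of_int (pos_part (m $ j)) - \<beta> $ j)
                        (of_int (neg_part (m $ j)) - \<alpha> $ j)
                        (of_int (pos_part (m $ j) + neg_part (m $ j) + 1))
                        (of_real ((cmod (z $ j))\<^sup>2))
             * (z $ j) powi pos_part (m $ j) * cnj (z $ j) powi neg_part (m $ j)))) \<and>
     (\<forall>(u :: complex ^ 'n \<Rightarrow> complex) (m :: int ^ 'n) c.
        (\<forall>z\<in>polydisc. u z =
           c * (\<Prod>j\<in>UNIV.
             hypergeo_F (of_int (pos_part (m $ j)) - \<beta> $ j)
                        (of_int (neg_part (m $ j)) - \<alpha> $ j)
                        (of_int (pos_part (m $ j) + neg_part (m $ j) + 1))
                        (of_real ((cmod (z $ j))\<^sup>2))
             * (z $ j) powi pos_part (m $ j) * cnj (z $ j) powi neg_part (m $ j))) \<longrightarrow>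
        homogeneous m u \<and> u \<in> sep_harmonic \<alpha> \<beta>)"
  unfolding hypergeo_mode_def[symmetric]
proof (intro conjI allI impI)
  fix u m assume "u \<in> sep_harmonic \<alpha> \<beta> \<and> homogeneous m u"
  then show "\<exists>c. \<forall>z\<in>polydisc. u z = c * (\<Prod>j\<in>UNIV. hypergeo_mode (\<alpha> $ j) (\<beta> $ j) (m $ j) (z $ j))"
    by (intro homogeneous_sep_harmonic_is_mode_product) auto
next
  fix u m c
  assume "\<forall>z\<in>polydisc. u z = c * (\<Prod>j\<in>UNIV. hypergeo_mode (\<alpha> $ j) (\<beta> $ j) (m $ j) (z $ j))"
  then show "homogeneous m u" "u \<in> sep_harmonic \<alpha> \<beta>"
    by (auto intro: mode_product_homogeneous[where c = c] mode_product_sep_harmonic[where c = c and m = m])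
qed

end
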